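(* Let $|q|<1$, $q\ne0$. (i) For every positive integer $N$, $${}_{8}\phi_{7}\left[\begin{matrix}k,\,q\sqrt k,\,-q\sqrt k,\,y,\,z,\,k\sqrt q,\,kq^{1+N}/(yz),\,q^{-N}\\ \sqrt k,\,-\sqrt k,\,qk/y,\,qk/z,\,\sqrt q,\,kq^{1+N},\,yzq^{-N}\end{matrix};q,\sqrt q\right]$$ $$=\frac{(qk,\,qk/(yz),\,q/y,\,q/z;q)_N}{(qk/y,\,qk/z,\,q,\,q/(yz);q)_N}\left(1+\sum_{n=1}^{N}\frac{(1+q^n)(y,\,z,\,kq^{1+N}/(yz),\,q^{-N};q)_n}{(q/y,\,q/z,\,q^{1+N},\,yzq^{-N}/k;q)_n}\left(\frac{\sqrt q}{k}\right)^n\right).$$ (ii) $$\sum_{n=0}^{\infty}\frac{(1-kq^{4n})(k;q)_{2n}\,q^{2n^2-n}}{(1-k)(q;q)_{2n}}=\frac{(kq^2;q^2)_\infty}{(q;q^2)_\infty}.$$ (iii) $$\sum_{n=0}^{\infty}\frac{(1-kq^{2n})(k;q)_n(-1)^nq^{n(n-1)/2}}{(1-k)(q;q)_n}=0.$$ (iv) $$\sum_{n=0}^{\infty}\frac{(1-kq^{4n})(-q;q^2)_n(k;q)_{2n}\,q^{n^2-n}}{(1-k)(-kq;q^2)_n(q;q)_{2n}}=\frac{(kq^2,-1;q^2)_\infty}{(-kq,q;q^2)_\infty}.$$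
   Context: For a base $t$ and $n\ge0$ or $n=\infty$, $(x;t)_n=\prod_{i=0}^{n-1}(1-xt^i)$ and $(x_1,\dots,x_m;t)_n=\prod_{j=1}^m(x_j;t)_n$. The basic hypergeometric series is ${}_{r+1}\phi_r\left[\begin{matrix}a_1,\dots,a_{r+1}\\ b_1,\dots,b_r\end{matrix};q,x\right]=\sum_{n\ge0}\frac{(a_1,\dots,a_{r+1};q)_n}{(q,b_1,\dots,b_r;q)_n}x^n$; when $q^{-N}$ is an upper parameter the series terminates, and the sum is over $0\le n\le N$. The parameters $k,y,z$ are complex numbers (nonzero in (i)) such that none of the denominators vanish; $\sqrt k,\sqrt q$ are fixed square roots. *)

theory Defs
  imports "HOL-Analysis.Analysis"
begin

definition qpoch :: "complex \<Rightarrow> complex \<Rightarrow> nat \<Rightarrow> complex" where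
  "qpoch x t n = (\<Prod>i<n. 1 - x * t ^ i)"

definition qpoch_inf :: "complex \<Rightarrow> complex \<Rightarrow> complex" where
  "qpoch_inf x t = (\<Prod>i. 1 - x * t ^ i)"

definition qpochs :: "complex list \<Rightarrow> complex \<Rightarrow> nat \<Rightarrow> complex" where
  "qpochs xs t n = (\<Prod>x\<leftarrow>xs. qpoch x t n)"

definition qpochs_inf :: "complex list \<Rightarrow> complex \<Rightarrow> complex" where
  "qpochs_inf xs t = (\<Prod>x\<leftarrow>xs. qpoch_inf x t)"

(* The series r+1_phi_r is the case length as = length bs + 1.  If q powi (- N) is an
   upper parameter, all numerators with index above N are 0, and since 0 / 0 = 0 the
   corresponding terms are 0 even if a lower parameter makes their denominator vanish
   too; see basic_hypergeometric_terminating. *)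
definition basic_hypergeometric ::
    "complex list \<Rightarrow> complex list \<Rightarrow> complex \<Rightarrow> complex \<Rightarrow> complex" where
  "basic_hypergeometric as bs q x =
     (\<Sum>n. qpochs as q n / qpochs (q # bs) q n * x ^ n)"

lemma convergent_prod_qpoch:
  fixes x t :: complex
  assumes "norm t < 1"
  shows "convergent_prod (\<lambda>i. 1 - x * t ^ i)"
proof (rule abs_convergent_prod_imp_convergent_prod)
  have "summable (\<lambda>i. norm x * norm t ^ i)"
    using assms by (intro summable_mult summable_geometric) auto
  then show "abs_convergent_prod (\<lambda>i. 1 - x * t ^ i)"
    by (simp add: abs_convergent_prod_conv_summable norm_mult norm_power)
qed

lemma basic_hypergeometric_terminating:
  assumes "q \<noteq> 0" and "q powi (- int N) \<in> set as"
  shows "basic_hypergeometric as bs q x =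
    (\<Sum>n\<le>N. qpochs as q n / qpochs (q # bs) q n * x ^ n)"
  unfolding basic_hypergeometric_def
proof (rule suminf_finite)
  fix n assume "n \<notin> {..N}"
  then have "N < n" by simp
  moreover have "1 - q powi (- int N) * q ^ N = 0"
    using assms(1) by (simp add: power_int_minus)
  ultimately have "qpoch (q powi (- int N)) q n = 0"
    unfolding qpoch_def by (metis finite_lessThan lessThan_iff prod_zero)
  then have "qpochs as q n = 0"
    unfolding qpochs_def prod_list_zero_iff using assms(2) by force
  then show "qpochs as q n / qpochs (q # bs) q n * x ^ n = 0"
    by simp
qed simp

end

(* Everything rests on Jackson's q-analogue of Dougall's sum, which follows from a WZ pair whose
   certificate factorises completely.

   For (i), write the quotient (k; q)_n (k sqrt q; q)_n / ((q; q)_n (sqrt q; q)_n) as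
   (k; w)_2n / (w; w)_2n with w = sqrt q.  It is a special value of a Rogers polynomial, hence a
   convolution of the coefficients (k; q)_r / (q; q)_r with weights w^r.  This is a WP Bailey pair
   relative to a = 1; exchanging the two sums leaves an inner sum that Jackson's formula evaluates.

   For (ii) and (iv), let one parameter of Jackson's sum in base q^2 tend to infinity, which leaves the
   6phi5 sum, take b = kq, and let n tend to infinity by dominated convergence.  The series (iii)
   telescopes. *)

theory Submission
  imports Defs
begin

section \<open>Shifted factorials\<close>

text \<open>The convolution behind (i) runs over 0 <= r <= 2n and is symmetric about r = n: the
  indices n + j and n - j carry the same product of coefficients, and their weights add up to w^n
  (w^j + w^(-j)). Hence alpha_0 = 1 and alpha_j = w^j + w^(-j) = w^(-j) (1 + q^j), which is the
  origin of the factor 1 + q^n on the right-hand side. The spare w^n turns the argument w of the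
  series into w^2 = q, the argument of Jackson's sum. With n = m + j the inner sum is Jackson's for
  a = k q^(2j) and b = k, so that aq/b = q^(2j+1).

  In (ii) and (iv) the choice b = kq in base q^2 gives aq^2/b = q for a = k. Then (k; q^2)_n (kq;
  q^2)_n and (q^2; q^2)_n (q; q^2)_n merge into (k; q)_2n and (q; q)_2n. The remaining parameter c
  is infinite in (ii) and -q in (iv).

  The obstacle is that only the denominators of the final formulas are known to be nonzero, while
  the induction on n and the limit in n meet others. Continuity disposes of them in the induction,
  and restriction to large n in the limit.\<close>

lemma qpoch_Suc: "qpoch x q (Suc n) = qpoch x q n * (1 - x * q ^ n)"
  by (simp add: qpoch_def)

lemma qpoch_0 [simp]: "qpoch x q 0 = 1"
  by (simp add: qpoch_def)

lemma qpoch_add: "qpoch x q (m + n) = qpoch x q m * qpoch (x * q ^ m) q n"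
  by (induction n) (simp_all add: qpoch_Suc power_add mult.assoc)

lemma qpoch_double: "qpoch x w (2 * n) = qpoch x (w\<^sup>2) n * qpoch (x * w) (w\<^sup>2) n"
  by (induction n) (simp_all add: qpoch_Suc power_mult power2_eq_square power_mult_distrib mult_ac)

lemma qpoch_eq_0_iff: "qpoch x q n = 0 \<longleftrightarrow> (\<exists>i<n. x * q ^ i = 1)"
  by (auto simp: qpoch_def)

text \<open>For nonzero x this is x^n (y/x; q)_n. At x = 0 it is (-y)^n q^(n(n-1)/2), which is what
  a parameter going to infinity leaves behind.\<close>

definition hqpoch :: "complex \<Rightarrow> complex \<Rightarrow> complex \<Rightarrow> nat \<Rightarrow> complex" where
  "hqpoch x y q n = (\<Prod>i<n. x - y * q ^ i)"

lemma hqpoch_0 [simp]: "hqpoch x y q 0 = 1"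
  by (simp add: hqpoch_def)

lemma hqpoch_Suc: "hqpoch x y q (Suc n) = hqpoch x y q n * (x - y * q ^ n)"
  by (simp add: hqpoch_def)

lemma hqpoch_Suc_shift: "hqpoch x y q (Suc n) = (x - y) * hqpoch x (y * q) q n"
  by (simp only: hqpoch_def prod.lessThan_Suc_shift) (simp add: mult.assoc)

lemma hqpoch_scale: "hqpoch (c * x) (c * y) q n = c ^ n * hqpoch x y q n"
  by (induction n) (simp_all add: hqpoch_Suc algebra_simps)

lemma hqpoch_one_left: "hqpoch 1 y q n = qpoch y q n"
  by (simp add: hqpoch_def qpoch_def)

lemma hqpoch_eq_0_iff: "hqpoch x y q n = 0 \<longleftrightarrow> (\<exists>i<n. x = y * q ^ i)"
  by (auto simp: hqpoch_def)

lemma tendsto_hqpoch [tendsto_intros]: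
  "\<lbrakk>(f \<longlongrightarrow> x) F; (g \<longlongrightarrow> y) F\<rbrakk>
     \<Longrightarrow> ((\<lambda>t. hqpoch (f t) (g t) q n) \<longlongrightarrow> hqpoch x y q n) F"
  unfolding hqpoch_def by (intro tendsto_intros)

section \<open>Jackson's terminating sum\<close>

text \<open>The parameters c, d of the terminating very-well-poised series of Jackson enter as
  u = 1/c and s = 1/d, and b comes with its partner \<beta> = aq/b, so that a q = b \<beta>.  No parameter is
  divided by, hence the confluent limits (c or d to infinity) are the values at u = 0 or s = 0, and
  k = 0 is admissible in the infinite series.\<close>

definition jackson_term ::
    "complex \<Rightarrow> complex \<Rightarrow> complex \<Rightarrow> complex \<Rightarrow> complex \<Rightarrow> complex \<Rightarrow> nat \<Rightarrow> nat \<Rightarrow> complex" where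
  "jackson_term q a b \<beta> u s n i =
     (1 - a * q ^ (2 * i)) / (1 - a)
       * (hqpoch 1 a q i * hqpoch 1 b q i * hqpoch u 1 q i * hqpoch s 1 q i
          * hqpoch q (b * \<beta>\<^sup>2 * u * s * q ^ n) q i * hqpoch (q ^ n) 1 q i * \<beta> ^ i)
       / (hqpoch 1 q q i * hqpoch 1 \<beta> q i * hqpoch 1 (a * q * u) q i * hqpoch 1 (a * q * s) q i
          * hqpoch (\<beta> * u * s * q ^ n) q q i * hqpoch 1 (a * q ^ Suc n) q i)"

text \<open>Classically (aq, aq/(bc), aq/(bd), aq/(cd); q)_n / (aq/b, aq/c, aq/d, aq/(bcd); q)_n.
  The fifth parameter e = a^2 q^(n+1) / (bcd) is forced by the balancing condition;
  \<open>jackson_term\<close> contains it as \<open>b * \<beta>\<^sup>2 * u * s * q ^ n\<close> over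
  \<open>q\<close>. There the scale factors of all \<open>hqpoch\<close> terms and
  \<open>\<beta> ^ i\<close> together amount to the classical q^i.\<close>

definition jackson_product ::
    "complex \<Rightarrow> complex \<Rightarrow> complex \<Rightarrow> complex \<Rightarrow> complex \<Rightarrow> nat \<Rightarrow> complex" where
  "jackson_product q a \<beta> u s n =
     hqpoch 1 (a * q) q n * hqpoch 1 (\<beta> * u) q n * hqpoch 1 (\<beta> * s) q n * hqpoch 1 (a * q * u * s) q n
     / (hqpoch 1 \<beta> q n * hqpoch 1 (a * q * u) q n * hqpoch 1 (a * q * s) q n * hqpoch 1 (\<beta> * u * s) q n)"

section \<open>The WZ equation and the recurrence in n\<close>

text \<open>With Q = q^n, X = q^i and B = \<open>\<beta>\<close> this is the WZ equation at index i
  + 1, freed of common factors and of denominators. Quotients of neighbouring terms are rational in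
  Q and X, so one polynomial identity serves all n and i.\<close>

lemma jackson_certificate_identity:
  fixes b B u s Q X q :: complex
  shows "- Q * (1 - b*B^2*u* s*Q^2) * ((1-b*B*X)*(1-b*q*X)*(u-q*X)*(s-q*X)*(1-b*B^2*u* s*Q*X)*(Q-X)*B
     - (1-q*X)*(1-B*X)*(1-b*B*u*X)*(1-b*B* s*X)*(B*u* s*Q-q*X)*(1-b*B*q*Q*X))
   = (1-b*B*q*X^2) * X* ((1-b*B^2*u* s*Q*X)*(1-q*Q)*(1-B*Q)*(1-b*B*u*Q)*(1-b*B* s*Q)*(B*u* s*Q-q*X)
      - (q-b*B^2*u* s*Q)*(Q-X)*(1-B*u*Q)*(1-B* s*Q)*(1-b*B*u* s*Q)*(1-b*B*q*Q*X))"
  by algebra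

context
  fixes q a b \<beta> u s :: complex and n :: nat
  assumes q0: "q \<noteq> 0" and q1: "\<And>j. q ^ Suc j \<noteq> 1"
    and ab: "a * q = b * \<beta>"
    and a1: "\<And>j. j \<le> 2 * Suc n \<Longrightarrow> a * q ^ j \<noteq> 1"
    and n1: "\<And>m. m \<le> n \<Longrightarrow> \<beta> * q ^ m \<noteq> 1"
    and n2: "\<And>m. m \<le> n \<Longrightarrow> a * q * u * q ^ m \<noteq> 1"
    and n3: "\<And>m. m \<le> n \<Longrightarrow> a * q * s * q ^ m \<noteq> 1"
    and n4: "\<And>m. m \<le> n \<Longrightarrow> \<beta> * u * s * q ^ m \<noteq> 1"
begin

text \<open>The shifted factorials shared by the terms of index i + 1 at n and at n + 1, once single
  factors are split off. Divided by q^i it is also the WZ certificate, up to a factor independent of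
  i.\<close>

definition jackson_common :: "nat \<Rightarrow> complex" where
  "jackson_common i =
     hqpoch 1 (a * q) q i * hqpoch 1 (b * q) q i * hqpoch u q q i * hqpoch s q q i
       * hqpoch q (b * \<beta>\<^sup>2 * u * s * q ^ Suc n) q i * hqpoch (q ^ n) 1 q i * \<beta> ^ i
     / (hqpoch 1 q q i * hqpoch 1 \<beta> q i * hqpoch 1 (a * q * u) q i * hqpoch 1 (a * q * s) q i
          * hqpoch (\<beta> * u * s * q ^ n) q q i * hqpoch 1 (a * q ^ Suc (Suc n)) q i)"

lemma a_neq_1: "a \<noteq> 1"
  using a1[of 0] by simp

lemma jackson_term_Suc:
  "jackson_term q a b \<beta> u s n (Suc i) =
     (1 - a * q ^ (2 * Suc i)) * (1 - b) * (1 - u) * (1 - s)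
       * (q - b * \<beta>\<^sup>2 * u * s * q ^ n) * (q ^ n - q ^ i) * \<beta>
     / ((1 - q * q ^ i) * (1 - \<beta> * q ^ i) * (1 - a * q * u * q ^ i) * (1 - a * q * s * q ^ i)
          * (\<beta> * u * s * q ^ n - q * q ^ i) * (1 - a * q ^ Suc n)) * jackson_common i"
proof -
  have "1 - a \<noteq> 0" using a_neq_1 by simp
  have e1: "hqpoch 1 a q (Suc i) = (1 - a) * hqpoch 1 (a * q) q i"
    "hqpoch 1 b q (Suc i) = (1 - b) * hqpoch 1 (b * q) q i"
    "hqpoch u 1 q (Suc i) = - ((1 - u) * hqpoch u q q i)"
    "hqpoch s 1 q (Suc i) = - ((1 - s) * hqpoch s q q i)"
    "hqpoch q (b * \<beta>\<^sup>2 * u * s * q ^ n) q (Suc i) =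
       (q - b * \<beta>\<^sup>2 * u * s * q ^ n) * hqpoch q (b * \<beta>\<^sup>2 * u * s * q ^ Suc n) q i"
    "hqpoch 1 (a * q ^ Suc n) q (Suc i) = (1 - a * q ^ Suc n) * hqpoch 1 (a * q ^ Suc (Suc n)) q i"
    by (simp_all only: hqpoch_Suc_shift power_Suc2 mult.assoc mult_1 minus_mult_left minus_diff_eq)
  show ?thesis
    unfolding jackson_term_def jackson_common_def e1
    unfolding hqpoch_Suc power_Suc mult_1
    using \<open>1 - a \<noteq> 0\<close> by (simp add: divide_inverse mult_ac)
qed

lemma jackson_term_Suc_Suc:
  "jackson_term q a b \<beta> u s (Suc n) (Suc i) =
     (1 - a * q ^ (2 * Suc i)) * (1 - b) * (1 - u) * (1 - s)
       * (q - b * \<beta>\<^sup>2 * u * s * q ^ Suc n * q ^ i) * (1 - q ^ Suc n) * \<beta>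
     / ((1 - q * q ^ i) * (1 - \<beta> * q ^ i) * (1 - a * q * u * q ^ i) * (1 - a * q * s * q ^ i)
          * (q * (1 - \<beta> * u * s * q ^ n)) * (1 - a * q ^ Suc (Suc n) * q ^ i)) * jackson_common i"
proof -
  have "1 - a \<noteq> 0" using a_neq_1 by simp
  have e1: "hqpoch 1 a q (Suc i) = (1 - a) * hqpoch 1 (a * q) q i"
    "hqpoch 1 b q (Suc i) = (1 - b) * hqpoch 1 (b * q) q i"
    "hqpoch u 1 q (Suc i) = - ((1 - u) * hqpoch u q q i)"
    "hqpoch s 1 q (Suc i) = - ((1 - s) * hqpoch s q q i)"
    by (simp_all only: hqpoch_Suc_shift power_Suc2 mult.assoc mult_1 minus_mult_left minus_diff_eq)
  \<comment> \<open>Splitting off the first factor at n + 1 leaves both entries q times those at n.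
    The powers q^i so produced in \<open>e2\<close> and \<open>e3\<close> cancel, one being in the
    numerator and the other in the denominator.\<close>
  have e2: "hqpoch (q ^ Suc n) 1 q (Suc i) = - ((1 - q ^ Suc n) * (q ^ i * hqpoch (q ^ n) 1 q i))"
    using hqpoch_scale[of q "q ^ n" 1 q i] by (simp add: hqpoch_Suc_shift algebra_simps)
  have e3: "hqpoch (\<beta> * u * s * q ^ Suc n) q q (Suc i) =
     - (q * (1 - \<beta> * u * s * q ^ n) * (q ^ i * hqpoch (\<beta> * u * s * q ^ n) q q i))"
    using hqpoch_scale[of q "\<beta> * u * s * q ^ n" q q i] by (simp add: hqpoch_Suc_shift algebra_simps)
  have cancel: "(1 - a) * (q ^ i * (inverse (1 - a) * inverse (q ^ i))) = 1"
    using \<open>1 - a \<noteq> 0\<close> q0 by (simp add: divide_simps)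
  show ?thesis
    unfolding jackson_term_def jackson_common_def e1 e2 e3
    unfolding hqpoch_Suc power_Suc[of \<beta>] mult_1
    using cancel by (simp add: divide_inverse mult_ac)
qed

lemma jackson_common_Suc:
  "jackson_common (Suc i) = jackson_common i *
     ((1 - a * q * q ^ i) * (1 - b * q * q ^ i) * (u - q * q ^ i) * (s - q * q ^ i)
       * (q - b * \<beta>\<^sup>2 * u * s * q ^ Suc n * q ^ i) * (q ^ n - q ^ i) * \<beta>
     / ((1 - q * q ^ i) * (1 - \<beta> * q ^ i) * (1 - a * q * u * q ^ i) * (1 - a * q * s * q ^ i)
          * (\<beta> * u * s * q ^ n - q * q ^ i) * (1 - a * q ^ Suc (Suc n) * q ^ i)))"
  unfolding jackson_common_def hqpoch_Suc power_Suc[of \<beta>]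
  by (simp add: divide_inverse mult_ac)

text \<open>D collects the denominators common to both terms, R is the extra one at n + 1, P the
  extra one at n, and X = q^i comes from the certificate.\<close>

lemma jackson_step_aux:
  fixes K W1 W2 A B P R D X N :: complex
  assumes "W1 * (N - D * P * R) = W2 * X * (A * P - B * R)"
    and "D \<noteq> 0" "P \<noteq> 0" "R \<noteq> 0" "X \<noteq> 0"
  shows "K * W2 * A / (D * R) - K * W2 * B / (D * P) = K * W1 * (N / (D * P * R) - 1) / X"
proof -
  have "K * W2 * A / (D * R) - K * W2 * B / (D * P) = K * (W2 * X * (A * P - B * R)) / (X * D * P * R)"
    using assms(2-) by (simp add: field_simps)
  also have "\<dots> = K * (W1 * (N - D * P * R)) / (X * D * P * R)"
    using assms(1) by simp
  also have "\<dots> = K * W1 * (N / (D * P * R) - 1) / X"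
    using assms(2-) by (simp add: field_simps)
  finally show ?thesis .
qed

lemma jackson_step:
  assumes i: "i < n"
  defines "Q \<equiv> q ^ n"
  shows "jackson_term q a b \<beta> u s (Suc n) (Suc i)
           * ((1 - \<beta> * Q) * (1 - a * q * u * Q) * (1 - a * q * s * Q) * (1 - \<beta> * u * s * Q))
         - jackson_term q a b \<beta> u s n (Suc i)
           * ((1 - a * q * Q) * (1 - \<beta> * u * Q) * (1 - \<beta> * s * Q) * (1 - a * q * u * s * Q))
       = - \<beta> * Q * (1 - b) * (1 - u) * (1 - s) * (1 - b * \<beta>\<^sup>2 * u * s * Q\<^sup>2)
           * (jackson_common (Suc i) / q ^ Suc i - jackson_common i / q ^ i)"
proof -
  define X where "X = q ^ i"
  define C where "C = jackson_common i"
  define K where "K = C * \<beta> * (1 - b) * (1 - u) * (1 - s)"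
  define D where "D = (1 - q * X) * (1 - \<beta> * X) * (1 - b * \<beta> * u * X) * (1 - b * \<beta> * s * X)"
  define P where "P = \<beta> * u * s * Q - q * X"
  define R where "R = 1 - b * \<beta> * q * Q * X"
  define W1 where "W1 = - Q * (1 - b * \<beta>\<^sup>2 * u * s * Q\<^sup>2)"
  define W2 where "W2 = 1 - b * \<beta> * q * X\<^sup>2"
  define A where "A = (1 - b * \<beta>\<^sup>2 * u * s * Q * X) * (1 - q * Q) * (1 - \<beta> * Q)
    * (1 - b * \<beta> * u * Q) * (1 - b * \<beta> * s * Q)"
  define B where "B = (q - b * \<beta>\<^sup>2 * u * s * Q) * (Q - X) * (1 - \<beta> * u * Q) * (1 - \<beta> * s * Q)
    * (1 - b * \<beta> * u * s * Q)"
  define N where "N = (1 - b * \<beta> * X) * (1 - b * q * X) * (u - q * X) * (s - q * X)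
    * (1 - b * \<beta>\<^sup>2 * u * s * Q * X) * (Q - X) * \<beta>"
  have X0: "X \<noteq> 0" and Q0: "Q \<noteq> 0" using q0 by (simp_all add: X_def Q_def)
  have aq: "a * q * y = b * \<beta> * y" for y by (simp add: ab)
  have D0: "D \<noteq> 0"
    unfolding D_def X_def using q1[of i] n1[of i] n2[of i] n3[of i] i by (auto simp: ab)
  \<comment> \<open>Here i < n matters: P is then a nonzero multiple of a factor of
    \<open>hqpoch 1 (\<beta> * u * s) q n\<close>. For i = n the hypotheses would not exclude P =
    0.\<close>
  have QX: "Q = q ^ (n - Suc i) * (q * X)"
    using i by (simp add: Q_def X_def flip: power_add power_Suc)
  have "P = (\<beta> * u * s * q ^ (n - Suc i) - 1) * (q * X)"
    by (simp add: P_def QX algebra_simps)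
  then have P0: "P \<noteq> 0" using n4[of "n - Suc i"] q0 X0 i by simp
  have R_eq: "1 - a * q ^ Suc (Suc n) * X = R"
  proof -
    have "a * q ^ Suc (Suc n) * X = (a * q) * (q * Q * X)" by (simp add: Q_def)
    then show ?thesis unfolding ab by (simp add: R_def mult.assoc)
  qed
  have R0: "R \<noteq> 0"
    unfolding R_eq[symmetric] X_def using a1[of "Suc (Suc n) + i"] i by (simp add: power_add mult_ac)
  have W0: "1 - \<beta> * u * s * Q \<noteq> 0" and V0: "1 - b * \<beta> * Q \<noteq> 0"
    using n4[of n] a1[of "Suc n"] by (auto simp: Q_def ab[symmetric] mult.assoc)
  have W2_eq: "1 - a * q ^ (2 * Suc i) = W2"
  proof -
    have "a * q ^ (2 * Suc i) = (a * q) * (q * X\<^sup>2)"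
      by (simp add: X_def power_mult power_mult_distrib power2_eq_square mult_ac)
    then show ?thesis unfolding ab by (simp add: W2_def mult.assoc)
  qed
  have T1: "jackson_term q a b \<beta> u s (Suc n) (Suc i)
           * ((1 - \<beta> * Q) * (1 - a * q * u * Q) * (1 - a * q * s * Q) * (1 - \<beta> * u * s * Q))
        = K * W2 * A / (D * R)"
  proof -
    have e1: "q - b * \<beta>\<^sup>2 * u * s * q ^ Suc n * X = q * (1 - b * \<beta>\<^sup>2 * u * s * Q * X)"
       and e: "q ^ Suc n = q * Q" "q ^ n = Q"
      by (simp_all add: Q_def X_def algebra_simps)
    show ?thesis
      unfolding jackson_term_Suc_Suc W2_eq unfolding X_def[symmetric] unfolding e1 R_eq unfolding e aq
      unfolding C_def[symmetric]
      using W0 q0 D0 R0 unfolding D_def by (simp add: K_def A_def divide_simps)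
  qed
  have T2: "jackson_term q a b \<beta> u s n (Suc i)
           * ((1 - a * q * Q) * (1 - \<beta> * u * Q) * (1 - \<beta> * s * Q) * (1 - a * q * u * s * Q))
       = K * W2 * B / (D * P)"
  proof -
    have e: "q - b * \<beta>\<^sup>2 * u * s * q ^ n = q - b * \<beta>\<^sup>2 * u * s * Q" "q ^ n - q ^ i = Q - X"
       "\<beta> * u * s * q ^ n - q * q ^ i = P"
      by (simp_all add: Q_def X_def P_def)
    have e2: "a * q * u * s * Q = b * \<beta> * u * s * Q" "a * q ^ Suc n = b * \<beta> * Q"
      using aq[of Q] by (simp_all add: ab Q_def mult.assoc)
    show ?thesis
      unfolding jackson_term_Suc e W2_eq unfolding X_def[symmetric] e2 aq
      unfolding C_def[symmetric]
      using V0 D0 P0 unfolding D_def by (simp add: K_def B_def divide_simps)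
  qed
  have T3: "jackson_common (Suc i) / q ^ Suc i - jackson_common i / q ^ i = C * (N / (D * P * R) - 1) / X"
  proof -
    have e: "q - b * \<beta>\<^sup>2 * u * s * q ^ Suc n * X = q * (1 - b * \<beta>\<^sup>2 * u * s * Q * X)"
       "\<beta> * u * s * q ^ n - q * X = P"
      by (simp_all add: Q_def P_def algebra_simps)
    have "jackson_common (Suc i) = C * (q * N / (D * P * R))"
      unfolding jackson_common_Suc X_def[symmetric] e R_eq aq unfolding C_def[symmetric] Q_def[symmetric]
      by (simp add: N_def D_def mult_ac)
    then show ?thesis
      using q0 X0 by (simp add: X_def[symmetric] C_def[symmetric] diff_divide_distrib right_diff_distrib)
  qed
  have key: "W1 * (N - D * P * R) = W2 * X * (A * P - B * R)"
    unfolding W1_def N_def D_def P_def R_def W2_def A_def B_def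
    using jackson_certificate_identity[of Q b \<beta> u s X q] by (simp only: mult.assoc mult_1)
  show ?thesis
    unfolding T1 T2 T3 jackson_step_aux[OF key D0 P0 R0 X0]
    by (simp add: K_def W1_def mult_ac)
qed

lemma jackson_telescope:
  defines "Q \<equiv> q ^ n"
  assumes "m \<le> n"
  shows "(\<Sum>i\<le>m. jackson_term q a b \<beta> u s (Suc n) i
           * ((1 - \<beta> * Q) * (1 - a * q * u * Q) * (1 - a * q * s * Q) * (1 - \<beta> * u * s * Q))
         - jackson_term q a b \<beta> u s n i
           * ((1 - a * q * Q) * (1 - \<beta> * u * Q) * (1 - \<beta> * s * Q) * (1 - a * q * u * s * Q)))
       = - \<beta> * Q * (1 - b) * (1 - u) * (1 - s) * (1 - b * \<beta>\<^sup>2 * u * s * Q\<^sup>2)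
           * (jackson_common m / q ^ m)"
  using assms(2)
proof (induction m)
  case 0
  \<comment> \<open>Both terms of index 0 equal 1, so the claim is that the difference of the two
    fourfold products factorises completely; \<open>a * q = b * \<beta>\<close> makes this a
    polynomial identity.\<close>
  have T: "jackson_term q a b \<beta> u s k 0 = 1" for k
    using a_neq_1 by (simp add: jackson_term_def)
  have C: "jackson_common 0 = 1" by (simp add: jackson_common_def)
  show ?case
    unfolding atMost_0 sum.insert[OF finite.emptyI, of 0, simplified]
    by (simp add: T C ab) algebra
next
  case (Suc m)
  then show ?case
    using jackson_step[of m] unfolding Q_def sum.atMost_Suc by (simp add: right_diff_distrib)
qed

text \<open>Summing the WZ equation over i <= n leaves the certificate at i = n. The sum at n + 1
  has one more term, which is exactly the negative of that boundary value, so what remains is the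
  first-order recurrence of \<open>jackson_product\<close>.\<close>

lemma jackson_recurrence:
  defines "Q \<equiv> q ^ n"
  shows "(\<Sum>i\<le>Suc n. jackson_term q a b \<beta> u s (Suc n) i)
           * ((1 - \<beta> * Q) * (1 - a * q * u * Q) * (1 - a * q * s * Q) * (1 - \<beta> * u * s * Q))
         = (\<Sum>i\<le>n. jackson_term q a b \<beta> u s n i)
           * ((1 - a * q * Q) * (1 - \<beta> * u * Q) * (1 - \<beta> * s * Q) * (1 - a * q * u * s * Q))"
proof -
  define D where "D = (1 - \<beta> * Q) * (1 - a * q * u * Q) * (1 - a * q * s * Q) * (1 - \<beta> * u * s * Q)"
  define C where "C = jackson_common n"
  have Q0: "Q \<noteq> 0" using q0 by (simp add: Q_def)
  have nz: "1 - \<beta> * Q \<noteq> 0" "1 - a * q * u * Q \<noteq> 0" "1 - a * q * s * Q \<noteq> 0"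
      "1 - \<beta> * u * s * Q \<noteq> 0" "1 - q * Q \<noteq> 0" "1 - a * q ^ (2 * Suc n) \<noteq> 0"
    using n1[of n] n2[of n] n3[of n] n4[of n] q1[of n] a1[of "2 * Suc n"] by (auto simp: Q_def)
  have e: "q - b * \<beta>\<^sup>2 * u * s * q ^ Suc n * q ^ n = q * (1 - b * \<beta>\<^sup>2 * u * s * Q\<^sup>2)"
       "a * q ^ Suc (Suc n) * q ^ n = a * q ^ (2 * Suc n)"
    by (simp_all add: Q_def power2_eq_square mult_2 mult_2_right power_add algebra_simps)
  have last: "jackson_term q a b \<beta> u s (Suc n) (Suc n) * D
      = \<beta> * Q * (1 - b) * (1 - u) * (1 - s) * (1 - b * \<beta>\<^sup>2 * u * s * Q\<^sup>2) * (C / q ^ n)"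
    unfolding jackson_term_Suc_Suc e unfolding C_def[symmetric] D_def Q_def[symmetric]
    using nz q0 Q0 by (simp add: divide_simps flip: Q_def)
  have "(\<Sum>i\<le>n. jackson_term q a b \<beta> u s (Suc n) i) * D
      - (\<Sum>i\<le>n. jackson_term q a b \<beta> u s n i)
           * ((1 - a * q * Q) * (1 - \<beta> * u * Q) * (1 - \<beta> * s * Q) * (1 - a * q * u * s * Q))
      = - (jackson_term q a b \<beta> u s (Suc n) (Suc n) * D)"
    unfolding last using jackson_telescope[OF order_refl]
    unfolding D_def C_def Q_def sum_subtractf sum_distrib_right by (simp only: minus_mult_left)
  then show ?thesis
    unfolding D_def[symmetric] by (simp add: distrib_right eq_diff_eq diff_eq_eq)
qed

end

lemma jackson_sum_generic:
  assumes q0: "q \<noteq> 0" and q1: "\<And>j. q ^ Suc j \<noteq> 1"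
    and ab: "a * q = b * \<beta>"
    and "\<And>j. j \<le> 2 * n \<Longrightarrow> a * q ^ j \<noteq> 1"
    and "\<And>m. m < n \<Longrightarrow> \<beta> * q ^ m \<noteq> 1"
    and "\<And>m. m < n \<Longrightarrow> a * q * u * q ^ m \<noteq> 1"
    and "\<And>m. m < n \<Longrightarrow> a * q * s * q ^ m \<noteq> 1"
    and "\<And>m. m < n \<Longrightarrow> \<beta> * u * s * q ^ m \<noteq> 1"
  shows "(\<Sum>i\<le>n. jackson_term q a b \<beta> u s n i) = jackson_product q a \<beta> u s n"
  using assms(4-)
proof (induction n)
  case 0
  then show ?case using 0(1)[of 0] by (simp add: jackson_term_def jackson_product_def)
next
  case (Suc n)
  let ?N = "(1 - a * q * q ^ n) * (1 - \<beta> * u * q ^ n) * (1 - \<beta> * s * q ^ n) * (1 - a * q * u * s * q ^ n)"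
  let ?D = "(1 - \<beta> * q ^ n) * (1 - a * q * u * q ^ n) * (1 - a * q * s * q ^ n) * (1 - \<beta> * u * s * q ^ n)"
  have D0: "?D \<noteq> 0" using Suc.prems(2-)[of n] by simp
  have "(\<Sum>i\<le>Suc n. jackson_term q a b \<beta> u s (Suc n) i) * ?D
      = (\<Sum>i\<le>n. jackson_term q a b \<beta> u s n i) * ?N"
    by (rule jackson_recurrence[OF q0 q1 ab]) (use Suc.prems in auto)
  also have "(\<Sum>i\<le>n. jackson_term q a b \<beta> u s n i) = jackson_product q a \<beta> u s n"
    by (rule Suc.IH) (use Suc.prems in auto)
  finally have "(\<Sum>i\<le>Suc n. jackson_term q a b \<beta> u s (Suc n) i) = jackson_product q a \<beta> u s n * ?N / ?D"
    using D0 by (simp add: eq_divide_eq)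
  also have "\<dots> = jackson_product q a \<beta> u s (Suc n)"
    by (simp add: jackson_product_def hqpoch_Suc divide_inverse mult_ac)
  finally show ?case .
qed

section \<open>Removal of exceptional parameter values by continuity\<close>

lemma hqpoch_nonzero_mono: "hqpoch x y q n \<noteq> 0 \<Longrightarrow> i \<le> n \<Longrightarrow> hqpoch x y q i \<noteq> 0"
  by (auto simp: hqpoch_eq_0_iff)

lemma eventually_at_mult_neq_1:
  fixes b c :: complex
  shows "\<forall>\<^sub>F t in at b. t * c \<noteq> 1"
  by (rule eventually_mono[OF eventually_neq_at_within[of "1 / c" b]]) (auto simp: divide_simps split: if_splits)

text \<open>The induction on n needs a q^j to differ from 1 also for exponents j that do not occur in the
  final denominators; the excluded values of b are isolated, so continuity in b removes them.\<close>

lemma jackson_sum: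
  assumes q0: "q \<noteq> 0" and q1: "\<And>j. q ^ Suc j \<noteq> 1"
    and ab: "a * q = b * \<beta>" and a1: "a \<noteq> 1"
    and nz: "hqpoch 1 \<beta> q n \<noteq> 0" "hqpoch 1 (a * q * u) q n \<noteq> 0" "hqpoch 1 (a * q * s) q n \<noteq> 0"
      "hqpoch 1 (\<beta> * u * s) q n \<noteq> 0" "hqpoch 1 (a * q ^ Suc n) q n \<noteq> 0"
  shows "(\<Sum>i\<le>n. jackson_term q a b \<beta> u s n i) = jackson_product q a \<beta> u s n"
proof -
  \<comment> \<open>When b is replaced by t, a must move to t \<open>\<beta>\<close> / q to keep
    \<open>a * q = b * \<beta>\<close>; \<open>\<beta>\<close>, u and s stay fixed.\<close>
  define f where "f = (\<lambda>t. t * \<beta> / q)"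
  have fb: "f b = a" using ab q0 by (simp add: f_def field_simps)
  have f [tendsto_intros]: "(f \<longlongrightarrow> a) (at b)"
    unfolding fb[symmetric] f_def by (intro tendsto_intros q0)
  \<comment> \<open>Up to powers of q and signs these are the factors of
    \<open>hqpoch 1 (\<beta> * u * s) q n\<close> in reverse order.\<close>
  have nz5: "hqpoch (\<beta> * u * s * q ^ n) q q n \<noteq> 0"
  proof
    assume "hqpoch (\<beta> * u * s * q ^ n) q q n = 0"
    then obtain i where i: "i < n" and *: "\<beta> * u * s * q ^ n = q * q ^ i"
      by (auto simp: hqpoch_eq_0_iff)
    have "q ^ n = q ^ (n - Suc i) * (q * q ^ i)"
      using i by (simp flip: power_add power_Suc)
    with * q0 have "\<beta> * u * s * q ^ (n - Suc i) = 1" by (simp add: mult.assoc)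
    with nz(4) i show False by (auto simp: hqpoch_eq_0_iff)
  qed
  have nz6: "hqpoch 1 q q n \<noteq> 0"
    using q1 by (auto simp: hqpoch_eq_0_iff)
  have nz': "hqpoch 1 \<beta> q i \<noteq> 0" "hqpoch 1 (a * q * u) q i \<noteq> 0" "hqpoch 1 (a * q * s) q i \<noteq> 0"
      "hqpoch 1 (a * q ^ Suc n) q i \<noteq> 0" "hqpoch (\<beta> * u * s * q ^ n) q q i \<noteq> 0"
      "hqpoch 1 q q i \<noteq> 0" if "i \<le> n" for i
    using nz nz5 nz6 hqpoch_nonzero_mono[OF _ that] by blast+
  have ev: "\<forall>\<^sub>F t in at b. \<forall>j\<le>m. f t * c j \<noteq> 1" for m :: nat and c
  proof -
    have "\<forall>\<^sub>F t in at b. \<forall>j\<in>{..m}. t * (\<beta> * c j / q) \<noteq> 1"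
      by (intro eventually_ball_finite ballI eventually_at_mult_neq_1 finite_atMost)
    then show ?thesis
      by (rule eventually_mono) (use q0 in \<open>auto simp: f_def mult.assoc\<close>)
  qed
  have "\<forall>\<^sub>F t in at b. (\<Sum>i\<le>n. jackson_term q (f t) t \<beta> u s n i) = jackson_product q (f t) \<beta> u s n"
    using ev[of "2 * n" "\<lambda>j. q ^ j"]
      tendsto_imp_eventually_ne[OF tendsto_hqpoch[OF tendsto_const
        tendsto_mult[OF tendsto_mult[OF f tendsto_const] tendsto_const]] nz(2)]
      tendsto_imp_eventually_ne[OF tendsto_hqpoch[OF tendsto_const
        tendsto_mult[OF tendsto_mult[OF f tendsto_const] tendsto_const]] nz(3)]
  proof eventually_elim
    case (elim t)
    show ?case
    proof (rule jackson_sum_generic[OF q0 q1])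
      show "f t * q = t * \<beta>" using q0 by (simp add: f_def)
    qed (use elim nz(1,4) in \<open>auto simp: hqpoch_eq_0_iff eq_commute[of 1]\<close>)
  qed
  moreover have "((\<lambda>t. \<Sum>i\<le>n. jackson_term q (f t) t \<beta> u s n i)
      \<longlongrightarrow> (\<Sum>i\<le>n. jackson_term q a b \<beta> u s n i)) (at b)"
    unfolding jackson_term_def using a1 nz'
    by (intro tendsto_intros) auto
  ultimately have "((\<lambda>t. jackson_product q (f t) \<beta> u s n)
      \<longlongrightarrow> (\<Sum>i\<le>n. jackson_term q a b \<beta> u s n i)) (at b)"
    by (rule Lim_transform_eventually[rotated])
  moreover have "((\<lambda>t. jackson_product q (f t) \<beta> u s n) \<longlongrightarrow> jackson_product q a \<beta> u s n) (at b)"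
    unfolding jackson_product_def using nz
    by (intro tendsto_intros) auto
  ultimately show ?thesis
    using tendsto_unique[OF at_neq_bot] by blast
qed

section \<open>A well-poised Bailey transformation\<close>

text \<open>The generating function of (k; w^2)_r / (w^2; w^2)_r is (kx; w^2)_inf / (x; w^2)_inf.
  Multiplying it by its rescaling under x to wx merges the two interlaced products of base w^2 into
  the product of base w.\<close>

lemma qpoch_quotient_convolution:
  fixes k w :: complex
  assumes w: "\<And>j. w ^ Suc j \<noteq> 1"
  defines "f \<equiv> \<lambda>r. qpoch k (w\<^sup>2) r / qpoch (w\<^sup>2) (w\<^sup>2) r"
  shows "(\<Sum>r\<le>m. f r * w ^ r * f (m - r)) = qpoch k w m / qpoch w w m"
proof -
  define G where "G c = Abs_fps (\<lambda>r. f r * c ^ r)" for c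
  define h where "h m = (\<Sum>r\<le>m. f r * w ^ r * f (m - r))" for m
  have f_Suc: "f (Suc r) * (1 - (w\<^sup>2) ^ Suc r) = f r * (1 - k * (w\<^sup>2) ^ r)" for r
    using w[of "2 * r + 1"]
    by (simp add: f_def qpoch_Suc power_mult[symmetric] power_add[symmetric] mult.commute)
  \<comment> \<open>The functional equation of (kcx; w^2)_inf / (cx; w^2)_inf under x -> w^2 x,
    obtained from the coefficients so that formal power series suffice.\<close>
  have G_eq: "(1 - fps_const c * fps_X) * G c = (1 - fps_const (k * c) * fps_X) * G (w\<^sup>2 * c)" for c
  proof (rule fps_ext)
    fix r
    show "fps_nth ((1 - fps_const c * fps_X) * G c) r = fps_nth ((1 - fps_const (k * c) * fps_X) * G (w\<^sup>2 * c)) r"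
    proof (cases r)
      case 0
      then show ?thesis by (simp add: G_def)
    next
      case (Suc j)
      have aux: "A - B = A * (v * V) - k * (B * V) \<Longrightarrow>
          A * (c * C) - c * (B * C) = A * (v * (V * (c * C))) - k * (c * (B * (V * C)))"
        for A B C v V :: complex
        by algebra
      have "f (Suc j) - f j = f (Suc j) * (w\<^sup>2) ^ Suc j - k * f j * (w\<^sup>2) ^ j"
        using f_Suc[of j] by (simp add: algebra_simps)
      then show ?thesis
        unfolding Suc by (simp add: G_def left_diff_distrib mult.assoc power_mult_distrib) (rule aux)
    qed
  qed
  have h_nth: "fps_nth (G (w * c) * G c) m = h m * c ^ m" for c m
    unfolding G_def h_def fps_mult_nth sum_distrib_right atLeast0AtMost
    by (rule sum.cong) (simp_all add: power_mult_distrib mult_ac flip: power_add)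
  \<comment> \<open>The functional equation is applied to one factor only, at c = 1. It links the
    product to its own rescaling x -> wx, which yields a recurrence in base w although each factor
    lives in base w^2.\<close>
  have "(1 - fps_X) * (G (w * 1) * G 1) = G w * ((1 - fps_const 1 * fps_X) * G 1)"
    by simp
  also have "\<dots> = (1 - fps_const k * fps_X) * (G (w * w) * G w)"
    unfolding G_eq by (simp add: power2_eq_square mult_ac)
  finally have H: "(1 - fps_X) * (G (w * 1) * G 1) = (1 - fps_const k * fps_X) * (G (w * w) * G w)" .
  have h_Suc: "h (Suc m) * (1 - w ^ Suc m) = h m * (1 - k * w ^ m)" for m
  proof -
    have "fps_nth ((1 - fps_X) * (G (w * 1) * G 1)) (Suc m) = h (Suc m) - h m"
      by (simp only: left_diff_distrib mult_1 fps_sub_nth h_nth fps_X_mult_nth) simp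
    moreover have "fps_nth ((1 - fps_const k * fps_X) * (G (w * w) * G w)) (Suc m)
        = h (Suc m) * w ^ Suc m - k * (h m * w ^ m)"
      by (simp only: left_diff_distrib mult_1 fps_sub_nth h_nth fps_X_mult_nth mult.assoc fps_mult_left_const_nth) simp
    ultimately have "h (Suc m) - h m = h (Suc m) * w ^ Suc m - k * (h m * w ^ m)"
      by (simp only: H)
    then show ?thesis by (simp add: algebra_simps)
  qed
  have "h m = qpoch k w m / qpoch w w m"
  proof (induction m)
    case 0
    then show ?case by (simp add: h_def f_def)
  next
    case (Suc m)
    have "h (Suc m) = h m * (1 - k * w ^ m) / (1 - w ^ Suc m)"
      using h_Suc[of m] w[of m] by (simp add: field_simps)
    then show ?case by (simp add: Suc qpoch_Suc)
  qed
  then show ?thesis by (simp add: h_def)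
qed

section \<open>Reversal of factors and rearrangement of finite sums\<close>

lemma qpoch_mult_q: "(1 - x) * qpoch (q * x) q n = qpoch x q n * (1 - x * q ^ n)"
  by (induction n) (simp_all add: qpoch_Suc mult_ac)

text \<open>Each of the last j factors 1 - x q^(N-i) equals -x q^(N-i) (1 - q^(i-N)/x). The product
  of powers of q is left unevaluated because it does not depend on x and cancels in
  quotients.\<close>

lemma qpoch_reverse:
  assumes "q \<noteq> 0" "x \<noteq> 0" "j \<le> N"
  shows "qpoch (q * x) q N =
    qpoch (q * x) q (N - j) * (\<Prod>i<j. - (q ^ (N - i))) * x ^ j * qpoch (q powi (- int N) / x) q j"
  using assms(3)
proof (induction j)
  case (Suc j)
  have "N - j = Suc (N - Suc j)" using Suc.prems by simp
  then have "qpoch (q * x) q (N - j) = qpoch (q * x) q (N - Suc j) * (1 - x * q ^ (N - j))"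
    by (simp add: qpoch_Suc mult_ac)
  moreover have "q ^ (N - j) * (q powi (- int N) * q ^ j) = 1"
    using assms(1) Suc.prems by (simp add: power_int_minus field_simps flip: power_add)
  then have "1 - x * q ^ (N - j) = - (q ^ (N - j)) * x * (1 - q powi (- int N) / x * q ^ j)"
    using assms(2) by (simp add: field_simps)
  ultimately show ?case
    using Suc by (simp add: qpoch_Suc mult_ac)
qed simp

text \<open>Folds a convolution about its midpoint; the middle index is its own mirror image and
  must be counted once.\<close>

lemma sum_symmetric_interval:
  fixes g :: "nat \<Rightarrow> 'a::comm_monoid_add"
  shows "(\<Sum>r\<le>2 * n. g r) = (\<Sum>j\<le>n. if j = 0 then g n else g (n + j) + g (n - j))"
proof -
  have "(\<Sum>r\<in>{n - m..n + m}. g r) = (\<Sum>j\<le>m. if j = 0 then g n else g (n + j) + g (n - j))"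
    if "m \<le> n" for m
    using that
  proof (induction m)
    case (Suc m)
    have "{n - Suc m..n + Suc m} = insert (n + Suc m) (insert (n - Suc m) {n - m..n + m})"
      using Suc.prems by auto
    moreover have "n + Suc m \<notin> insert (n - Suc m) {n - m..n + m}" "n - Suc m \<notin> {n - m..n + m}"
      using Suc.prems by auto
    ultimately show ?case
      using Suc by (simp add: add_ac)
  qed simp
  from this[of n] show ?thesis by (simp add: atLeast0AtMost mult_2)
qed

lemma sum_triangle_swap:
  fixes h :: "nat \<Rightarrow> nat \<Rightarrow> 'a::comm_monoid_add"
  shows "(\<Sum>n\<le>N. \<Sum>j\<le>n. h n j) = (\<Sum>j\<le>N. \<Sum>m\<le>N - j. h (m + j) j)"
proof -
  have "(\<Sum>n\<le>N. \<Sum>j\<le>n. h n j) = (\<Sum>(j,m)\<in>{(j,m). j + m \<le> N}. h (m + j) j)"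
    by (simp add: sum.triangle_reindex_eq)
  also have "{(j,m). j + m \<le> N} = Sigma {..N} (\<lambda>j. {..N - j})"
    by auto
  finally show ?thesis by (simp add: sum.Sigma)
qed

section \<open>The Bailey transform and its inner sum\<close>

text \<open>For a Bailey pair relative to a = 1, q^n times this is the weight of beta_n,
  \<open>bailey_ratio\<close> gives the kernel between alpha_j and beta_n, and
  \<open>bailey_factor\<close> times \<open>bailey_image\<close> times (q/k)^j is the resulting
  weight of alpha_j.\<close>

definition bailey_weight ::
    "complex \<Rightarrow> complex \<Rightarrow> complex \<Rightarrow> complex \<Rightarrow> nat \<Rightarrow> nat \<Rightarrow> complex" where
  "bailey_weight q k y z N n = (1 - k * q ^ (2 * n)) / (1 - k)
     * (qpoch y q n * qpoch z q n * qpoch (k * q ^ (1 + N) / (y * z)) q n * qpoch (q powi (- int N)) q n)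
     / (qpoch (q * k / y) q n * qpoch (q * k / z) q n * qpoch (k * q ^ (1 + N)) q n
         * qpoch (y * z * q powi (- int N)) q n)"

definition bailey_ratio :: "complex \<Rightarrow> complex \<Rightarrow> nat \<Rightarrow> complex" where
  "bailey_ratio q k r = qpoch k q r / qpoch q q r"

definition bailey_factor :: "complex \<Rightarrow> complex \<Rightarrow> complex \<Rightarrow> complex \<Rightarrow> nat \<Rightarrow> complex" where
  "bailey_factor q k y z N = qpoch (q * k) q N * qpoch (q * k / (y * z)) q N * qpoch (q / y) q N * qpoch (q / z) q N
     / (qpoch (q * k / y) q N * qpoch (q * k / z) q N * qpoch q q N * qpoch (q / (y * z)) q N)"

definition bailey_image ::
    "complex \<Rightarrow> complex \<Rightarrow> complex \<Rightarrow> complex \<Rightarrow> nat \<Rightarrow> nat \<Rightarrow> complex" where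
  "bailey_image q k y z N n =
     qpoch y q n * qpoch z q n * qpoch (k * q ^ (1 + N) / (y * z)) q n * qpoch (q powi (- int N)) q n
     / (qpoch (q / y) q n * qpoch (q / z) q n * qpoch (q ^ (1 + N)) q n * qpoch (y * z * q powi (- int N) / k) q n)"

lemma bailey_cancel:
  fixes E :: "'a::field"
  assumes "Y1 \<noteq> 0" "Z1 \<noteq> 0" "G \<noteq> 0" "M \<noteq> 0" "H \<noteq> 0" "c \<noteq> 0" "kj \<noteq> 0" "E \<noteq> 0"
  shows "qj * (K * G) * (t1 * t2 * t3 * t4) * (Yn * Zn * Kn) / (Q * Qj * Ky * Kz * (G * H * In))
    = K * (Kn * E * (kj * c) * M) * (Y1 * Yn) * (Z1 * Zn) / (Ky * Kz * Q * (In * E * c * H))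
       * (t1 * t2 * t3 * t4 / (Y1 * Z1 * Qj * M)) * (qj / kj)"
proof -
  have "E * (M * (Y1 * (Z1 * (c * (kj * (inverse E * (inverse M * (inverse Y1
      * (inverse Z1 * (inverse c * inverse kj)))))))))) = 1"
    using assms by (simp add: field_simps)
  then show ?thesis
    using assms(3,5) by (simp add: divide_inverse mult_ac)
qed

context
  fixes q k y z :: complex and N :: nat
  assumes q0: "q \<noteq> 0" and q1: "\<And>j. q ^ Suc j \<noteq> 1"
    and k0: "k \<noteq> 0" and y0: "y \<noteq> 0" and z0: "z \<noteq> 0"
    and k1: "\<And>j. j \<le> N \<Longrightarrow> k * q ^ (2 * j) \<noteq> 1"
    and nz1: "qpoch (q * k / y) q N \<noteq> 0" and nz2: "qpoch (q * k / z) q N \<noteq> 0"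
    and nz3: "qpoch (k * q ^ (1 + N)) q N \<noteq> 0"
    and nz4: "qpoch (q / (y * z)) q N \<noteq> 0"
    and nz5: "qpoch (q / y) q N \<noteq> 0" and nz6: "qpoch (q / z) q N \<noteq> 0"
    and nz7: "qpoch (y * z * q powi (- int N)) q N \<noteq> 0"
    and nz8: "qpoch (y * z * q powi (- int N) / k) q N \<noteq> 0"
begin

text \<open>\<open>bailey_ratio q k m\<close> contributes b = k and the denominator (q; q)_m;
  \<open>bailey_ratio q k (m + 2 * j)\<close> contributes a = k q^(2j) and \<open>\<beta>\<close> =
  q^(2j+1). The shift by j turns y and z into c = y q^j and d = z q^j, and q^(-N) into
  q^(-(N-j)).\<close>

lemma bailey_weight_shift:
  assumes "j \<le> N"
  shows "bailey_weight q k y z N (m + j) * q ^ m * (bailey_ratio q k m * bailey_ratio q k (m + 2 * j))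
    = bailey_weight q k y z N j * bailey_ratio q k (2 * j)
      * jackson_term q (k * q ^ (2 * j)) k (q ^ Suc (2 * j)) (1 / (y * q ^ j)) (1 / (z * q ^ j)) (N - j) m"
proof -
  define p where "p = q powi (- int N)"
  define c where "c = q ^ Suc (N - j) / (y * z)"
  have pq: "q ^ (N - j) * (p * q ^ j) = 1"
    using q0 assms by (simp add: p_def power_int_minus field_simps flip: power_add)
  have qN: "q ^ N = q ^ (N - j) * q ^ j" using assms by (simp flip: power_add)
  have c0: "c \<noteq> 0" using q0 y0 z0 by (simp add: c_def)
  have h: "hqpoch (1 / (x * q ^ j)) 1 q m = (1 / (x * q ^ j)) ^ m * qpoch (x * q ^ j) q m" if "x \<noteq> 0" for x
    using hqpoch_scale[of "1 / (x * q ^ j)" 1 "x * q ^ j" q m] that q0 by (simp add: hqpoch_one_left)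
  have h5: "hqpoch q (k * (q ^ Suc (2 * j))\<^sup>2 * (1 / (y * q ^ j)) * (1 / (z * q ^ j)) * q ^ (N - j)) q m
      = q ^ m * qpoch (k * q ^ (1 + N) / (y * z) * q ^ j) q m"
  proof -
    have "k * (q ^ Suc (2 * j))\<^sup>2 * (1 / (y * q ^ j)) * (1 / (z * q ^ j)) * q ^ (N - j)
        = q * (k * q ^ (1 + N) / (y * z) * q ^ j)"
      using q0 y0 z0 by (simp add: qN power2_eq_square power_mult divide_simps mult_2 power_add)
    then show ?thesis
      using hqpoch_scale[of q 1 "k * q ^ (1 + N) / (y * z) * q ^ j" q m] by (simp add: hqpoch_one_left)
  qed
  have h6: "hqpoch (q ^ (N - j)) 1 q m = (q ^ (N - j)) ^ m * qpoch (p * q ^ j) q m"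
    using hqpoch_scale[of "q ^ (N - j)" 1 "p * q ^ j" q m] pq by (simp add: hqpoch_one_left)
  have h7: "hqpoch (q ^ Suc (2 * j) * (1 / (y * q ^ j)) * (1 / (z * q ^ j)) * q ^ (N - j)) q q m
      = c ^ m * qpoch (y * z * p * q ^ j) q m"
  proof -
    have "q ^ Suc (2 * j) * (1 / (y * q ^ j)) * (1 / (z * q ^ j)) * q ^ (N - j) = c"
      using q0 y0 z0 by (simp add: c_def divide_simps mult_2 power_add)
    moreover have "c * (y * z * p * q ^ j) = q"
      using y0 z0 pq by (simp add: c_def)
    ultimately show ?thesis
      using hqpoch_scale[of c 1 "y * z * p * q ^ j" q m] by (simp add: hqpoch_one_left)
  qed
  have h8: "k * q ^ (2 * j) * q * (1 / (x * q ^ j)) = q * k / x * q ^ j" if "x \<noteq> 0" for x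
    using q0 that by (simp add: divide_simps mult_2 power_add)
  have h9: "k * q ^ (2 * j) * q ^ Suc (N - j) = k * q ^ (1 + N) * q ^ j" "q ^ Suc (2 * j) = q * q ^ (2 * j)"
    by (simp_all add: qN mult_2 power_add)
  \<comment> \<open>The scale factors that separate \<open>hqpoch\<close> from \<open>qpoch\<close>
    collapse to Jackson's argument q.\<close>
  have scal: "(1 / (y * q ^ j)) ^ m * (1 / (z * q ^ j)) ^ m * q ^ m * (q ^ (N - j)) ^ m
      * (q ^ Suc (2 * j)) ^ m / c ^ m = q ^ m"
  proof -
    have "1 / (y * q ^ j) * (1 / (z * q ^ j)) * q * q ^ (N - j) * q ^ Suc (2 * j) / c = q"
      using q0 y0 z0 by (simp add: c_def divide_simps mult_2 power_add)
    then show ?thesis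
      by (metis power_mult_distrib power_divide)
  qed
  have J: "jackson_term q (k * q ^ (2 * j)) k (q ^ Suc (2 * j)) (1 / (y * q ^ j)) (1 / (z * q ^ j)) (N - j) m
    = (1 - k * q ^ (2 * (m + j))) / (1 - k * q ^ (2 * j)) * q ^ m
      * (qpoch (k * q ^ (2 * j)) q m * qpoch k q m * qpoch (y * q ^ j) q m * qpoch (z * q ^ j) q m
         * qpoch (k * q ^ (1 + N) / (y * z) * q ^ j) q m * qpoch (p * q ^ j) q m)
      / (qpoch q q m * qpoch (q * q ^ (2 * j)) q m * qpoch (q * k / y * q ^ j) q m
         * qpoch (q * k / z * q ^ j) q m * qpoch (y * z * p * q ^ j) q m * qpoch (k * q ^ (1 + N) * q ^ j) q m)"
    (is "_ = ?R")
  proof -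
    have e: "k * q ^ (2 * j) * q ^ (2 * m) = k * q ^ (2 * (m + j))"
      by (simp add: power_add mult_ac)
    have "jackson_term q (k * q ^ (2 * j)) k (q ^ Suc (2 * j)) (1 / (y * q ^ j)) (1 / (z * q ^ j)) (N - j) m
      = (1 - k * q ^ (2 * (m + j))) / (1 - k * q ^ (2 * j))
       * ((1 / (y * q ^ j)) ^ m * (1 / (z * q ^ j)) ^ m * q ^ m * (q ^ (N - j)) ^ m
      * (q ^ Suc (2 * j)) ^ m / c ^ m)
      * (qpoch (k * q ^ (2 * j)) q m * qpoch k q m * qpoch (y * q ^ j) q m * qpoch (z * q ^ j) q m
         * qpoch (k * q ^ (1 + N) / (y * z) * q ^ j) q m * qpoch (p * q ^ j) q m)
      / (qpoch q q m * qpoch (q * q ^ (2 * j)) q m * qpoch (q * k / y * q ^ j) q m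
         * qpoch (q * k / z * q ^ j) q m * qpoch (y * z * p * q ^ j) q m * qpoch (k * q ^ (1 + N) * q ^ j) q m)"
      unfolding jackson_term_def h5 h6 h7 h8[OF y0] h8[OF z0] h[OF y0] h[OF z0] h9(1) e hqpoch_one_left
      unfolding h9(2)
      by (simp only: divide_inverse inverse_mult_distrib mult_ac)
    then show ?thesis unfolding scal .
  qed
  have "1 - k * q ^ (2 * j) \<noteq> 0" using k1[OF assms] by simp
  have e: "qpoch x q (m + j) = qpoch x q j * qpoch (x * q ^ j) q m"
     "qpoch x q (m + 2 * j) = qpoch x q (2 * j) * qpoch (x * q ^ (2 * j)) q m" for x
    by (metis qpoch_add add.commute)+
  show ?thesis
    unfolding J bailey_weight_def bailey_ratio_def e unfolding p_def[symmetric]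
    using \<open>1 - k * q ^ (2 * j) \<noteq> 0\<close> by (simp add: divide_inverse mult_ac)
qed

lemma bailey_inner_sum:
  assumes "j \<le> N"
  shows "(\<Sum>m\<le>N - j. bailey_weight q k y z N (m + j) * q ^ (m + j) * (bailey_ratio q k m * bailey_ratio q k (m + 2 * j)))
     = bailey_factor q k y z N * bailey_image q k y z N j * (q / k) ^ j"
proof -
  define p where "p = q powi (- int N)"
  define n where "n = N - j"
  define u s where "u = 1 / (y * q ^ j)" and "s = 1 / (z * q ^ j)"
  define a where "a = k * q ^ (2 * j)"
  have jn: "j + n = N" using assms by (simp add: n_def)
  have mono: "qpoch x q i \<noteq> 0" if "qpoch x q N \<noteq> 0" "i \<le> N" for x i
    using hqpoch_nonzero_mono[of 1 x q N i] that by (simp add: hqpoch_one_left)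
  have split: "qpoch x q N = qpoch x q j * qpoch (x * q ^ j) q n" for x
    using qpoch_add[of x q j n] by (simp add: jn)
  \<comment> \<open>Needed at x = k for the numerator and at x = 1 for the denominator, which is why
    \<open>q * 1\<close> is kept unsimplified.\<close>
  have split2: "qpoch (q * x) q (2 * j) * qpoch (q * x * q ^ (2 * j)) q n
      = qpoch (q * x) q N * qpoch (x * q ^ (1 + N)) q j" for x
  proof -
    have "2 * j + n = N + j" using jn by simp
    then show ?thesis
      by (metis qpoch_add mult.assoc mult.commute plus_1_eq_Suc power_Suc)
  qed
  have e: "a * q * u = q * k / y * q ^ j" "a * q * s = q * k / z * q ^ j"
      "q ^ Suc (2 * j) * u = q / y * q ^ j" "q ^ Suc (2 * j) * s = q / z * q ^ j"
      "a * q * u * s = q * k / (y * z)" "q ^ Suc (2 * j) * u * s = q / (y * z)"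
      "a * q = q * k * q ^ (2 * j)" "q ^ Suc (2 * j) = q * 1 * q ^ (2 * j)"
    using q0 y0 z0 by (simp_all add: a_def u_def s_def divide_simps mult_2 power_add)
  have e': "a * q ^ Suc n = k * q ^ (1 + N) * q ^ j"
    by (simp add: a_def jn[symmetric] mult_2 power_add)
  have "(\<Sum>m\<le>n. jackson_term q a k (q ^ Suc (2 * j)) u s n m) = jackson_product q a (q ^ Suc (2 * j)) u s n"
  proof (rule jackson_sum[OF q0 q1])
    show "a * q = k * q ^ Suc (2 * j)" "a \<noteq> 1"
      using k1[OF assms] by (simp_all add: a_def)
    show "hqpoch 1 (q ^ Suc (2 * j)) q n \<noteq> 0"
      using q1 by (auto simp: hqpoch_one_left qpoch_eq_0_iff simp flip: power_add power_Suc)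
    show "hqpoch 1 (a * q * u) q n \<noteq> 0" "hqpoch 1 (a * q * s) q n \<noteq> 0"
      using split[of "q * k / y"] split[of "q * k / z"] nz1 nz2 unfolding e(1,2) hqpoch_one_left by auto
    show "hqpoch 1 (q ^ Suc (2 * j) * u * s) q n \<noteq> 0"
      unfolding e(6) hqpoch_one_left using mono[OF nz4] jn by simp
    show "hqpoch 1 (a * q ^ Suc n) q n \<noteq> 0"
      using split[of "k * q ^ (1 + N)"] nz3 unfolding e' hqpoch_one_left by simp
  qed
  then have J: "(\<Sum>m\<le>n. jackson_term q a k (q ^ Suc (2 * j)) u s n m) =
     qpoch (q * k * q ^ (2 * j)) q n * qpoch (q / y * q ^ j) q n * qpoch (q / z * q ^ j) q n
       * qpoch (q * k / (y * z)) q n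
     / (qpoch (q * 1 * q ^ (2 * j)) q n * qpoch (q * k / y * q ^ j) q n * qpoch (q * k / z * q ^ j) q n
       * qpoch (q / (y * z)) q n)"
    unfolding jackson_product_def hqpoch_one_left e(5,6) unfolding e(1-4) unfolding e(7,8) .
  have W: "(1 - k * q ^ (2 * j)) / (1 - k) * qpoch k q (2 * j) = qpoch (q * k) q (2 * j)"
    using qpoch_mult_q[of k q "2 * j"] k1[of 0] by (simp add: divide_simps mult_ac)
  define E where "E = (\<Prod>i<j. - (q ^ (N - i)))"
  have E0: "E \<noteq> 0" using q0 by (simp add: E_def)
  \<comment> \<open>Jackson's formula leaves (qk/(yz); q)_(N-j) over (q/(yz); q)_(N-j). Completing
    both to length N trades the lower parameter yzq^(-N) for yzq^(-N)/k and brings in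
    k^(-j).\<close>
  have r1: "qpoch (q * k / (y * z)) q N = qpoch (q * k / (y * z)) q n * E * (k / (y * z)) ^ j * qpoch (y * z * p / k) q j"
    using qpoch_reverse[OF q0, of "k / (y * z)" j N] assms k0 y0 z0 by (simp add: E_def p_def n_def mult_ac)
  have r2: "qpoch (q / (y * z)) q N = qpoch (q / (y * z)) q n * E * (1 / (y * z)) ^ j * qpoch (y * z * p) q j"
    using qpoch_reverse[OF q0, of "1 / (y * z)" j N] assms y0 z0 by (simp add: E_def p_def n_def mult_ac)
  have "(\<Sum>m\<le>n. bailey_weight q k y z N (m + j) * q ^ (m + j) * (bailey_ratio q k m * bailey_ratio q k (m + 2 * j)))
     = (\<Sum>m\<le>n. q ^ j * (bailey_weight q k y z N (m + j) * q ^ m * (bailey_ratio q k m * bailey_ratio q k (m + 2 * j))))"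
    by (simp add: power_add mult_ac)
  also have "\<dots> = q ^ j * (bailey_weight q k y z N j * bailey_ratio q k (2 * j)
      * (\<Sum>m\<le>n. jackson_term q a k (q ^ Suc (2 * j)) u s n m))"
    unfolding bailey_weight_shift[OF assms] a_def u_def s_def n_def by (simp only: sum_distrib_left)
  also have "\<dots> = q ^ j * ((1 - k * q ^ (2 * j)) / (1 - k) * qpoch k q (2 * j) * qpoch (q * k * q ^ (2 * j)) q n)
      * (qpoch y q j * qpoch z q j * qpoch (k * q ^ (1 + N) / (y * z)) q j * qpoch p q j)
      * (qpoch (q / y * q ^ j) q n * qpoch (q / z * q ^ j) q n * qpoch (q * k / (y * z)) q n)
     / ((qpoch (q * 1) q (2 * j) * qpoch (q * 1 * q ^ (2 * j)) q n)
       * (qpoch (q * k / y) q j * qpoch (q * k / y * q ^ j) q n)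
       * (qpoch (q * k / z) q j * qpoch (q * k / z * q ^ j) q n)
       * (qpoch (k * q ^ (1 + N)) q j * qpoch (y * z * p) q j * qpoch (q / (y * z)) q n))"
    unfolding J bailey_weight_def bailey_ratio_def p_def[symmetric]
    by (simp only: divide_inverse inverse_mult_distrib mult_ac mult_1_right mult_1_left)
  also have "\<dots> = q ^ j * (qpoch (q * k) q N * qpoch (k * q ^ (1 + N)) q j)
      * (qpoch y q j * qpoch z q j * qpoch (k * q ^ (1 + N) / (y * z)) q j * qpoch p q j)
      * (qpoch (q / y * q ^ j) q n * qpoch (q / z * q ^ j) q n * qpoch (q * k / (y * z)) q n)
     / ((qpoch q q N * qpoch (q ^ (1 + N)) q j)
       * qpoch (q * k / y) q N
       * qpoch (q * k / z) q N
       * (qpoch (k * q ^ (1 + N)) q j * qpoch (y * z * p) q j * qpoch (q / (y * z)) q n))"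
    unfolding W split2 split[symmetric] by (simp only: mult_1_left mult_1_right)
  also have "\<dots> = bailey_factor q k y z N * bailey_image q k y z N j * (q / k) ^ j"
  proof -
    have "qpoch (q / y) q j \<noteq> 0" "qpoch (q / z) q j \<noteq> 0" "qpoch (k * q ^ (1 + N)) q j \<noteq> 0"
       "qpoch (y * z * p / k) q j \<noteq> 0" "qpoch (y * z * p) q j \<noteq> 0"
      using mono nz5 nz6 nz3 nz7 nz8 assms unfolding p_def by blast+
    moreover have "(k / (y * z)) ^ j = k ^ j * (1 / (y * z)) ^ j"
      by (simp flip: power_mult_distrib)
    moreover have "(1 / (y * z)) ^ j \<noteq> 0" "k ^ j \<noteq> 0" using y0 z0 k0 by simp_all
    ultimately show ?thesis
      unfolding bailey_factor_def bailey_image_def p_def[symmetric] split[of "q / y"] split[of "q / z"] r1 r2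
        power_divide[of q k]
      using E0 by (simp only:) (rule bailey_cancel)
  qed
  finally show ?thesis unfolding n_def .
qed

end

section \<open>The terminating transformation (i)\<close>

lemma bailey_terminating_sum:
  fixes q k y z sk sq :: complex and N :: nat
  assumes q1: "\<And>j. q ^ Suc j \<noteq> 1" and q0: "q \<noteq> 0"
    and N0: "N > 0" and k0: "k \<noteq> 0" and y0: "y \<noteq> 0" and z0: "z \<noteq> 0"
    and sk: "sk\<^sup>2 = k" and sq: "sq\<^sup>2 = q"
    and den1: "\<forall>n\<le>N. qpochs [q, sk, - sk, q * k / y, q * k / z, sq, k * q ^ (1 + N),
                        y * z * q powi (- int N)] q n \<noteq> 0"
    and den2: "qpochs [q * k / y, q * k / z, q, q / (y * z)] q N \<noteq> 0"
    and den3: "\<forall>n\<in>{1..N}. qpochs [q / y, q / z, q ^ (1 + N), y * z * q powi (- int N) / k] q n \<noteq> 0"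
  shows "basic_hypergeometric
          [k, q * sk, - q * sk, y, z, k * sq, k * q ^ (1 + N) / (y * z), q powi (- int N)]
          [sk, - sk, q * k / y, q * k / z, sq, k * q ^ (1 + N), y * z * q powi (- int N)]
          q sq
        = qpochs [q * k, q * k / (y * z), q / y, q / z] q N
            / qpochs [q * k / y, q * k / z, q, q / (y * z)] q N
          * (1 + (\<Sum>n=1..N. (1 + q ^ n)
                * qpochs [y, z, k * q ^ (1 + N) / (y * z), q powi (- int N)] q n
                / qpochs [q / y, q / z, q ^ (1 + N), y * z * q powi (- int N) / k] q n
                * (sq / k) ^ n))"
proof -
  have sq0: "sq \<noteq> 0" using sq q0 by auto
  have sq1: "sq ^ Suc j \<noteq> 1" for j
  proof
    assume "sq ^ Suc j = 1"
    then have "(sq ^ Suc j)\<^sup>2 = 1" by simp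
    then have "q ^ Suc j = 1" by (metis sq power_mult mult.commute)
    with q1 show False by blast
  qed
  have nz: "qpoch sk q N \<noteq> 0" "qpoch (- sk) q N \<noteq> 0" "qpoch (q * k / y) q N \<noteq> 0"
     "qpoch (q * k / z) q N \<noteq> 0" "qpoch (k * q ^ (1 + N)) q N \<noteq> 0"
     "qpoch (y * z * q powi (- int N)) q N \<noteq> 0" "qpoch (q / (y * z)) q N \<noteq> 0"
     "qpoch (q / y) q N \<noteq> 0" "qpoch (q / z) q N \<noteq> 0" "qpoch (y * z * q powi (- int N) / k) q N \<noteq> 0"
    using den1 den2 bspec[OF den3, of N] N0 by (auto simp: qpochs_def)
  \<comment> \<open>The factors of (sk, -sk; q)_N cover only j < N; the case j = N is the last
    factor of (kq^(1+N); q)_N.\<close>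
  have k1: "k * q ^ (2 * j) \<noteq> 1" if "j \<le> N" for j
  proof (cases "j = N")
    case True
    show ?thesis
    proof
      assume "k * q ^ (2 * j) = 1"
      then have "k * q ^ (1 + N) * q ^ (N - 1) = 1"
        using True N0 by (simp add: mult_2 mult.assoc flip: power_add power_Suc)
      then show False using nz(5) N0 by (force simp: qpoch_eq_0_iff)
    qed
  next
    case False
    then have "sk * q ^ j \<noteq> 1" "sk * q ^ j \<noteq> - 1"
      using nz(1,2) that by (auto simp: qpoch_eq_0_iff minus_equation_iff eq_commute[of "- 1"])
    then have "(sk * q ^ j)\<^sup>2 \<noteq> 1" by (simp add: power2_eq_1_iff)
    then show ?thesis by (simp add: power_mult_distrib sk power_mult[symmetric] mult.commute[of j])
  qed
  define V where "V = bailey_weight q k y z N"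
  define f where "f = bailey_ratio q k"
  define W where "W = bailey_factor q k y z N"
  define Y where "Y = bailey_image q k y z N"
  define c where "c j = (if j = 0 then 1 else sq ^ j + 1 / sq ^ j)" for j
  note inner = bailey_inner_sum[OF q0 q1 k0 y0 z0 k1 nz(3-5,7-9,6,10), folded V_def f_def W_def Y_def]
  \<comment> \<open>In base q the quotient is (k; w)_2n / (w; w)_2n with w = \<open>sq\<close>. The
    convolution yields one factor w^n, and the argument of the series another, whence q^n.\<close>
  have beta: "sq ^ n * (qpoch k q n * qpoch (k * sq) q n / (qpoch q q n * qpoch sq q n))
      = q ^ n * (\<Sum>j\<le>n. c j * (f (n - j) * f (n + j)))" for n
  proof -
    have f_eq: "f r = qpoch k (sq\<^sup>2) r / qpoch (sq\<^sup>2) (sq\<^sup>2) r" for r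
      unfolding f_def bailey_ratio_def sq by (rule refl)
    have "qpoch k q n * qpoch (k * sq) q n / (qpoch q q n * qpoch sq q n) = qpoch k sq (2 * n) / qpoch sq sq (2 * n)"
      using sq by (simp add: qpoch_double power2_eq_square)
    also have "\<dots> = (\<Sum>r\<le>2 * n. f r * sq ^ r * f (2 * n - r))"
      unfolding f_eq using qpoch_quotient_convolution[of sq k "2 * n", OF sq1] by simp
    also have "\<dots> = (\<Sum>j\<le>n. sq ^ n * (c j * (f (n - j) * f (n + j))))"
      unfolding sum_symmetric_interval
    proof (rule sum.cong)
      fix j assume "j \<in> {..n}"
      then have j: "j \<le> n" "2 * n - (n + j) = n - j" "2 * n - (n - j) = n + j" by auto
      have "sq ^ n = sq ^ (n - j) * sq ^ j" using j by (simp flip: power_add)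
      then show "(if j = 0 then f n * sq ^ n * f (2 * n - n)
            else f (n + j) * sq ^ (n + j) * f (2 * n - (n + j)) + f (n - j) * sq ^ (n - j) * f (2 * n - (n - j)))
          = sq ^ n * (c j * (f (n - j) * f (n + j)))"
      proof (cases "j = 0")
        case False
        have "sq ^ j * (1 / sq ^ j) = 1" using sq0 by simp
        moreover have "G * (S * J * J) * F + F * S * G = S * J * ((J + J') * (F * G))"
          if "J * J' = 1" for F G S J J' :: complex
          using that by algebra
        ultimately show ?thesis
          using False unfolding j c_def power_add[of sq n j] \<open>sq ^ n = sq ^ (n - j) * sq ^ j\<close> by simp
      qed (simp add: c_def)
    qed simp
    finally have "sq ^ n * (qpoch k q n * qpoch (k * sq) q n / (qpoch q q n * qpoch sq q n))
      = (sq ^ n * sq ^ n) * (\<Sum>j\<le>n. c j * (f (n - j) * f (n + j)))"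
      by (simp add: sum_distrib_left mult_ac)
    also have "sq ^ n * sq ^ n = q ^ n"
      by (simp add: sq[symmetric] power2_eq_square power_mult_distrib)
    finally show ?thesis .
  qed
  have summand: "qpochs [k, q * sk, - q * sk, y, z, k * sq, k * q ^ (1 + N) / (y * z), q powi (- int N)] q n
      / qpochs [q, sk, - sk, q * k / y, q * k / z, sq, k * q ^ (1 + N), y * z * q powi (- int N)] q n * sq ^ n
      = (\<Sum>j\<le>n. V n * q ^ n * c j * (f (n - j) * f (n + j)))" if "n \<le> N" for n
  proof -
    have nzn: "qpoch sk q n \<noteq> 0" "qpoch (- sk) q n \<noteq> 0"
      using spec[OF den1, of n] that by (auto simp: qpochs_def)
    have "1 - k \<noteq> 0" using k1[of 0] by simp
    \<comment> \<open>Multiplying the instances of \<open>qpoch_mult_q\<close> at sk and -sk turns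
      the four square-root parameters into the very-well-poised factor.\<close>
    have "(1 - sk) * (1 - - sk) = 1 - k" "(1 - sk * q ^ n) * (1 - - sk * q ^ n) = 1 - k * q ^ (2 * n)"
      by (simp_all add: sk[symmetric] power_mult power2_eq_square algebra_simps power_mult_distrib)
    then have "(1 - k) * (qpoch (q * sk) q n * qpoch (q * - sk) q n)
        = qpoch sk q n * qpoch (- sk) q n * (1 - k * q ^ (2 * n))"
      using arg_cong2[OF qpoch_mult_q[of sk q n] qpoch_mult_q[of "- sk" q n], of "(*)"]
      by (metis mult.assoc mult.left_commute)
    then have "qpoch (q * sk) q n * qpoch (- q * sk) q n
        = (1 - k * q ^ (2 * n)) / (1 - k) * (qpoch sk q n * qpoch (- sk) q n)"
      using \<open>1 - k \<noteq> 0\<close> by (simp add: eq_divide_eq mult_ac)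
    then have e0: "qpoch (q * sk) q n * (qpoch (- q * sk) q n * r)
        = (1 - k * q ^ (2 * n)) / (1 - k) * (qpoch sk q n * (qpoch (- sk) q n * r))" for r
      by (simp only: mult.assoc[symmetric])
    have e: "qpochs [k, q * sk, - q * sk, y, z, k * sq, k * q ^ (1 + N) / (y * z), q powi (- int N)] q n
        = qpoch k q n * ((1 - k * q ^ (2 * n)) / (1 - k) * (qpoch sk q n * qpoch (- sk) q n))
          * (qpoch y q n * qpoch z q n * qpoch (k * sq) q n
          * qpoch (k * q ^ (1 + N) / (y * z)) q n * qpoch (q powi (- int N)) q n)"
      unfolding qpochs_def by (simp only: list.map prod_list.Cons prod_list.Nil mult_1_right mult.assoc e0)
    have cancel: "qpoch sk q n * (qpoch (- sk) q n * (inverse (qpoch sk q n) * inverse (qpoch (- sk) q n))) = 1"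
      using nzn by (simp add: divide_simps)
    have "qpochs [k, q * sk, - q * sk, y, z, k * sq, k * q ^ (1 + N) / (y * z), q powi (- int N)] q n
      / qpochs [q, sk, - sk, q * k / y, q * k / z, sq, k * q ^ (1 + N), y * z * q powi (- int N)] q n * sq ^ n
      = V n * (sq ^ n * (qpoch k q n * qpoch (k * sq) q n / (qpoch q q n * qpoch sq q n)))"
      unfolding e V_def bailey_weight_def using cancel by (simp add: qpochs_def divide_inverse mult_ac)
    also have "\<dots> = (\<Sum>j\<le>n. V n * q ^ n * c j * (f (n - j) * f (n + j)))"
      unfolding beta by (simp only: sum_distrib_left mult.assoc)
    finally show ?thesis .
  qed
  have "basic_hypergeometric
          [k, q * sk, - q * sk, y, z, k * sq, k * q ^ (1 + N) / (y * z), q powi (- int N)]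
          [sk, - sk, q * k / y, q * k / z, sq, k * q ^ (1 + N), y * z * q powi (- int N)]
          q sq = (\<Sum>n\<le>N. \<Sum>j\<le>n. V n * q ^ n * c j * (f (n - j) * f (n + j)))"
    by (subst basic_hypergeometric_terminating[OF q0, where N = N], simp, rule sum.cong[OF refl])
       (rule summand, simp)
  also have "\<dots> = (\<Sum>j\<le>N. \<Sum>m\<le>N - j. c j * (V (m + j) * q ^ (m + j) * (f m * f (m + 2 * j))))"
    unfolding sum_triangle_swap by (simp add: mult_ac mult_2_right add_ac)
  also have "\<dots> = (\<Sum>j\<le>N. c j * (W * Y j * (q / k) ^ j))"
    by (rule sum.cong) (simp_all add: inner flip: sum_distrib_left)
  also have "\<dots> = W * (1 + (\<Sum>j=1..N. (1 + q ^ j) * Y j * (sq / k) ^ j))"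
  proof -
    have "c j * (W * Y j * (q / k) ^ j) = W * ((1 + q ^ j) * Y j * (sq / k) ^ j)" if "j \<in> {1..N}" for j
    proof -
      have "c j * q ^ j = (1 + q ^ j) * sq ^ j"
        using that sq0 by (simp add: c_def sq[symmetric] power2_eq_square power_mult_distrib field_simps)
      then show ?thesis by (simp add: power_divide)
    qed
    then have "(\<Sum>j=1..N. c j * (W * Y j * (q / k) ^ j)) = W * (\<Sum>j=1..N. (1 + q ^ j) * Y j * (sq / k) ^ j)"
      unfolding sum_distrib_left by (rule sum.cong[OF refl])
    moreover have "c 0 * (W * Y 0 * (q / k) ^ 0) = W"
      by (simp add: c_def Y_def bailey_image_def)
    ultimately show ?thesis
      by (simp add: atMost_atLeast0 sum.atLeast_Suc_atMost distrib_left)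
  qed
  finally show ?thesis
    unfolding W_def Y_def bailey_factor_def bailey_image_def by (simp add: qpochs_def mult.assoc)
qed

section \<open>Infinite series\<close>

lemma tendsto_qpoch_inf:
  assumes "norm t < 1"
  shows "qpoch x t \<longlonglongrightarrow> qpoch_inf x t"
  using convergent_prod_LIMSEQ[OF convergent_prod_qpoch[OF assms, of x]]
  unfolding qpoch_inf_def qpoch_def[abs_def] LIMSEQ_lessThan_iff_atMost .

lemma qpoch_inf_nonzero:
  assumes "norm t < 1" "\<And>i. x * t ^ i \<noteq> 1"
  shows "qpoch_inf x t \<noteq> 0"
  unfolding qpoch_inf_def
  using assms prodinf_nonzero[OF convergent_prod_qpoch[OF assms(1), of x]] by simp

lemma qpoch_inf_0 [simp]: "qpoch_inf 0 t = 1"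
  by (simp add: qpoch_inf_def)

lemma power_neq_1:
  fixes t :: complex
  assumes "norm t < 1"
  shows "t ^ Suc j \<noteq> 1"
proof
  assume "t ^ Suc j = 1"
  then have "norm t ^ Suc j = 1" by (metis norm_one norm_power)
  moreover have "norm t ^ Suc j < 1" using assms by (simp add: power_less_one_iff del: power_Suc)
  ultimately show False by simp
qed

lemma inverse_qpoch_factor_bound:
  fixes x t :: complex
  assumes "norm t < 1" "\<And>i. x * t ^ i \<noteq> 1"
  obtains B where "\<And>i. norm (inverse (1 - x * t ^ i)) \<le> B"
proof -
  have "(\<lambda>i. inverse (1 - x * t ^ i)) \<longlonglongrightarrow> inverse (1 - x * 0)"
    by (intro tendsto_intros LIMSEQ_power_zero assms(1)) simp
  then have "Bseq (\<lambda>i. inverse (1 - x * t ^ i))"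
    by (intro convergent_imp_Bseq convergentI)
  then obtain B where "\<forall>i. norm (inverse (1 - x * t ^ i)) \<le> B"
    by (auto elim: BseqE)
  then show ?thesis using that by blast
qed

text \<open>The product is K^i r^(i(i-1)/2). However large K is, the ratio K r^i of successive terms
  tends to 0, so crude bounds on single factors are good enough.\<close>

lemma summable_quadratic_power:
  fixes C K r :: real
  assumes "0 \<le> r" "r < 1"
  shows "summable (\<lambda>i. C * (\<Prod>m<i. K * r ^ m))"
proof -
  have "(\<lambda>i. K * r ^ i) \<longlonglongrightarrow> K * 0"
    using assms by (intro tendsto_intros LIMSEQ_power_zero) simp
  from tendstoD[OF this, of "1 / 2"]
  have "\<forall>\<^sub>F i in sequentially. norm (K * r ^ i) < 1 / 2"
    by (simp add: dist_norm)
  then obtain N where N: "\<And>i. i \<ge> N \<Longrightarrow> norm (K * r ^ i) < 1 / 2"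
    by (auto simp: eventually_sequentially)
  have "summable (\<lambda>i. \<Prod>m<i. K * r ^ m)"
  proof (rule summable_ratio_test[of "1 / 2" N])
    fix i assume "i \<ge> N"
    then show "norm (\<Prod>m<Suc i. K * r ^ m) \<le> 1 / 2 * norm (\<Prod>m<i. K * r ^ m)"
      using mult_left_mono[OF less_imp_le[OF N[of i]], of "norm (\<Prod>m<i. K * r ^ m)"]
      by (simp only: prod.lessThan_Suc norm_mult) (simp add: mult_ac)
  qed simp
  then show ?thesis by (rule summable_mult)
qed

text \<open>At s = 0 the factors of d and of the fifth parameter cancel up to scale, leaving the
  terminating 6phi5 sum. As n grows, \<open>hqpoch (p ^ n) 1 p i\<close> becomes
  \<open>hqpoch 0 1 p i\<close>, a quadratic power of p, so that the limit series converges for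
  every u, including 0.\<close>

lemma quadratic_sum_limit:
  fixes p k b \<beta> u :: complex
  assumes p: "norm p < 1" and p0: "p \<noteq> 0" and kb: "k * p = b * \<beta>" and k1: "k \<noteq> 1"
    and \<beta>: "\<And>i. \<beta> * p ^ i \<noteq> 1" and u: "\<And>i. k * p * u * p ^ i \<noteq> 1"
  shows "(\<lambda>i. (1 - k * p ^ (2 * i)) / (1 - k)
       * (qpoch k p i * qpoch b p i * hqpoch u 1 p i * hqpoch 0 1 p i * \<beta> ^ i)
       / (qpoch p p i * qpoch \<beta> p i * qpoch (k * p * u) p i))
     sums (qpoch_inf (k * p) p * qpoch_inf (\<beta> * u) p / (qpoch_inf \<beta> p * qpoch_inf (k * p * u) p))"
    (is "?g sums _")
proof -
  define T where "T i n = (1 - k * p ^ (2 * i)) / (1 - k)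
       * (qpoch k p i * qpoch b p i * hqpoch u 1 p i * hqpoch (p ^ n) 1 p i * \<beta> ^ i)
       / (qpoch p p i * qpoch \<beta> p i * qpoch (k * p * u) p i * qpoch (k * p ^ Suc n) p i)" for i n
  have jackson_T: "jackson_term p k b \<beta> u 0 n i = T i n" for i n
  proof -
    have "hqpoch p 0 p i = p ^ i" by (simp add: hqpoch_def)
    moreover have "hqpoch 0 p p i = p ^ i * hqpoch 0 1 p i"
      using hqpoch_scale[of p 0 1 p i] by simp
    moreover have "hqpoch 0 1 p i \<noteq> 0" using p0 by (simp add: hqpoch_eq_0_iff)
    ultimately show ?thesis
      using p0 by (simp add: jackson_term_def T_def hqpoch_one_left qpoch_def[of 0] mult_ac)
  qed
  have pn: "(\<lambda>n. p ^ n) \<longlonglongrightarrow> 0" by (rule LIMSEQ_power_zero[OF p])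
  \<comment> \<open>For small n some 1 - k p^(n+1+m) may vanish. Past this threshold all of them
    have modulus at least 1/2, uniformly in m.\<close>
  have small: "\<forall>\<^sub>F n in sequentially. norm (k * p ^ Suc n) < 1 / 2"
  proof -
    have "(\<lambda>n. k * p ^ Suc n) \<longlonglongrightarrow> k * 0"
      by (rule tendsto_mult[OF tendsto_const LIMSEQ_Suc[OF pn]])
    from tendstoD[OF this, of "1 / 2"] show ?thesis by (simp add: dist_norm)
  qed
  have pow1: "norm (p ^ m) \<le> 1" for m
    using p by (simp add: norm_power power_le_one)
  have far: "norm (inverse (1 - k * p ^ Suc n * p ^ m)) \<le> 2" if "norm (k * p ^ Suc n) < 1 / 2" for n m
  proof -
    have "norm (k * p ^ Suc n * p ^ m) \<le> norm (k * p ^ Suc n) * 1"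
      unfolding norm_mult[of "k * p ^ Suc n"] by (intro mult_left_mono pow1) simp
    then have "1 / 2 \<le> norm (1 - k * p ^ Suc n * p ^ m)"
      using norm_triangle_ineq2[of 1 "k * p ^ Suc n * p ^ m"] that by simp
    then show ?thesis using le_imp_inverse_le[of "1/2" "norm (1 - k * p ^ Suc n * p ^ m)"]
      by (simp add: norm_inverse)
  qed
  have qq: "p * p ^ i \<noteq> 1" for i using power_neq_1[OF p, of i] by simp
  obtain B1 where B1: "\<And>i. norm (inverse (1 - p * p ^ i)) \<le> B1"
    using inverse_qpoch_factor_bound[OF p qq] by blast
  obtain B2 where B2: "\<And>i. norm (inverse (1 - \<beta> * p ^ i)) \<le> B2"
    using inverse_qpoch_factor_bound[OF p \<beta>] by blast
  obtain B3 where B3: "\<And>i. norm (inverse (1 - k * p * u * p ^ i)) \<le> B3"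
    using inverse_qpoch_factor_bound[OF p u] by blast
  have B0: "0 \<le> B1" "0 \<le> B2" "0 \<le> B3"
    using B1[of 0] B2[of 0] B3[of 0] norm_ge_zero order_trans by blast+
  \<comment> \<open>One bound per factor of \<open>F\<close> below: the first 2 belongs to p^n -
    p^m, whose |p|^m is kept apart, and the last 2 to the denominator with k p^(n+1).\<close>
  define K where "K = (1 + norm k) * (1 + norm b) * (norm u + 1) * 2 * norm \<beta> * B1 * B2 * B3 * 2"
  define C where "C = (1 + norm k) / norm (1 - k)"
  have CK0: "0 \<le> C" "0 \<le> K"
    unfolding C_def K_def by (intro mult_nonneg_nonneg divide_nonneg_nonneg add_nonneg_nonneg B0; simp)+
  have num: "norm (1 - x * p ^ m) \<le> 1 + norm x" for x m
    using norm_triangle_ineq4[of 1 "x * p ^ m"] mult_left_mono[OF pow1[of m], of "norm x"]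
    by (simp add: norm_mult)
  have bound: "norm (T i n) \<le> C * (\<Prod>m<i. K * norm p ^ m)" if n: "norm (k * p ^ Suc n) < 1 / 2" for i n
  proof (cases "i \<le> n")
    case False
    then have "hqpoch (p ^ n) 1 p i = 0" by (auto simp: hqpoch_eq_0_iff intro!: exI[of _ n])
    then have "T i n = 0" by (simp add: T_def)
    moreover have "0 \<le> C * (\<Prod>m<i. K * norm p ^ m)"
      using CK0 by (auto intro!: mult_nonneg_nonneg prod_nonneg)
    ultimately show ?thesis by simp
  next
    case True
    define F where "F m = (1 - k * p ^ m) * (1 - b * p ^ m) * (u - 1 * p ^ m) * (p ^ n - 1 * p ^ m) * \<beta>
       * inverse (1 - p * p ^ m) * inverse (1 - \<beta> * p ^ m) * inverse (1 - k * p * u * p ^ m)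
       * inverse (1 - k * p ^ Suc n * p ^ m)" for m
    have "T i n = (1 - k * p ^ (2 * i)) / (1 - k) * (\<Prod>m<i. F m)"
      unfolding T_def F_def qpoch_def hqpoch_def prod.distrib prod_inversef[unfolded o_def] prod_constant card_lessThan
      by (simp only: divide_inverse inverse_mult_distrib mult_ac)
    moreover have "norm ((1 - k * p ^ (2 * i)) / (1 - k)) \<le> C"
      unfolding C_def norm_divide by (intro divide_right_mono num) simp
    moreover have "norm (\<Prod>m<i. F m) \<le> (\<Prod>m<i. K * norm p ^ m)"
      unfolding prod_norm[symmetric]
    proof (rule prod_mono, intro conjI)
      fix m assume m: "m \<in> {..<i}"
      \<comment> \<open>This factor alone supplies the decay |p|^m of the majorant. It uses m < i <=
        n, which explains the case distinction; beyond n the terms are 0.\<close>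
      have "norm (p ^ n) \<le> norm p ^ m"
        unfolding norm_power using m True p by (intro power_decreasing) auto
      then have d: "norm (p ^ n - 1 * p ^ m) \<le> 2 * norm p ^ m"
        using norm_triangle_ineq4[of "p ^ n" "p ^ m"] by (simp add: norm_power)
      have e: "norm (u - 1 * p ^ m) \<le> norm u + 1"
        using norm_triangle_ineq4[of u "p ^ m"] pow1[of m] by simp
      have "norm (F m) \<le> (1 + norm k) * (1 + norm b) * (norm u + 1) * (2 * norm p ^ m) * norm \<beta> * B1 * B2 * B3 * 2"
        unfolding F_def norm_mult
        by (intro mult_mono num d e B1 B2 B3 far[OF n] mult_nonneg_nonneg order_refl norm_ge_zero B0
            add_nonneg_nonneg zero_le_power) auto
      then show "norm (F m) \<le> K * norm p ^ m" by (simp only: K_def mult_ac)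
    qed simp
    ultimately show ?thesis
      by (simp only: norm_mult) (intro mult_mono, auto simp: C_def)
  qed
  have g: "T i \<longlonglongrightarrow> ?g i" for i
  proof -
    have nz: "qpoch p p i \<noteq> 0" "qpoch \<beta> p i \<noteq> 0" "qpoch (k * p * u) p i \<noteq> 0"
      using qq \<beta> u by (auto simp: qpoch_eq_0_iff)
    have "(\<lambda>n. hqpoch 1 (k * p ^ Suc n) p i) \<longlonglongrightarrow> hqpoch 1 (k * 0) p i"
      by (rule tendsto_hqpoch[OF tendsto_const tendsto_mult[OF tendsto_const LIMSEQ_Suc[OF pn]]])
    then have 1: "(\<lambda>n. qpoch (k * p ^ Suc n) p i) \<longlonglongrightarrow> 1"
      by (simp add: hqpoch_one_left qpoch_def[of 0])
    have "T i \<longlonglongrightarrow> (1 - k * p ^ (2 * i)) / (1 - k)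
       * (qpoch k p i * qpoch b p i * hqpoch u 1 p i * hqpoch 0 1 p i * \<beta> ^ i)
       / (qpoch p p i * qpoch \<beta> p i * qpoch (k * p * u) p i * 1)"
      unfolding T_def[abs_def] using nz by (intro tendsto_intros 1 pn) (use k1 in auto)
    then show ?thesis by simp
  qed
  have "\<forall>\<^sub>F (i,n) in at_top \<times>\<^sub>F sequentially. norm (T i n) \<le> C * (\<Prod>m<i. K * norm p ^ m)"
    using iffD2[OF eventually_prod2[OF trivial_limit_at_top_linorder] small] by (rule eventually_mono) (auto intro: bound)
  from tannerys_theorem[OF g this summable_quadratic_power[OF norm_ge_zero p] sequentially_bot]
  have "summable (\<lambda>i. norm (?g i))" and lim: "(\<lambda>n. \<Sum>i. T i n) \<longlonglongrightarrow> (\<Sum>i. ?g i)"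
    by blast+
  from this(1) have summ: "summable ?g" by (rule summable_norm_cancel)
  have "\<forall>\<^sub>F n in sequentially. (\<Sum>i. T i n) = jackson_product p k \<beta> u 0 n"
    using small
  proof eventually_elim
    case (elim n)
    have "(\<Sum>i. T i n) = (\<Sum>i\<le>n. T i n)"
    proof (rule suminf_finite)
      fix i assume "i \<notin> {..n}"
      then have "hqpoch (p ^ n) 1 p i = 0" by (auto simp: hqpoch_eq_0_iff intro!: exI[of _ n])
      then show "T i n = 0" by (simp add: T_def)
    qed simp
    also have "\<dots> = jackson_product p k \<beta> u 0 n"
      unfolding jackson_T[symmetric]
    proof (rule jackson_sum[OF p0 _ kb k1])
      show "p ^ Suc j \<noteq> 1" for j by (rule power_neq_1[OF p])
      show "hqpoch 1 (k * p ^ Suc n) p n \<noteq> 0"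
      proof
        assume "hqpoch 1 (k * p ^ Suc n) p n = 0"
        then obtain m where "k * p ^ Suc n * p ^ m = 1" by (auto simp: hqpoch_eq_0_iff)
        moreover have "norm (k * p ^ Suc n * p ^ m) \<le> norm (k * p ^ Suc n) * 1"
          unfolding norm_mult[of "k * p ^ Suc n"] by (intro mult_left_mono pow1) simp
        ultimately show False using elim by simp
      qed
    qed (use \<beta> u in \<open>auto simp: hqpoch_one_left qpoch_eq_0_iff\<close>)
    finally show ?case .
  qed
  with lim have "(\<lambda>n. jackson_product p k \<beta> u 0 n) \<longlonglongrightarrow> (\<Sum>i. ?g i)"
    by (rule Lim_transform_eventually)
  moreover have "(\<lambda>n. jackson_product p k \<beta> u 0 n) \<longlonglongrightarrow>
      qpoch_inf (k * p) p * qpoch_inf (\<beta> * u) p / (qpoch_inf \<beta> p * qpoch_inf (k * p * u) p)"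
    unfolding jackson_product_def hqpoch_one_left
    by (simp add: qpoch_def[of 0], intro tendsto_intros tendsto_qpoch_inf p)
       (use qpoch_inf_nonzero[OF p] \<beta> u in auto)
  ultimately have "(\<Sum>i. ?g i) = qpoch_inf (k * p) p * qpoch_inf (\<beta> * u) p / (qpoch_inf \<beta> p * qpoch_inf (k * p * u) p)"
    by (rule LIMSEQ_unique)
  with summ show ?thesis by (simp add: sums_iff)
qed

section \<open>The quadratic series (ii) and (iv)\<close>

lemma hqpoch_0_1: "hqpoch 0 1 (q\<^sup>2) i = (- 1) ^ i * q ^ (i\<^sup>2 - i)"
proof (induction i)
  case (Suc i)
  have "i \<le> i\<^sup>2" by (simp add: power2_eq_square)
  then have "(Suc i)\<^sup>2 - Suc i = (i\<^sup>2 - i) + 2 * i" by (simp add: power2_eq_square)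
  then show ?case using Suc by (simp add: hqpoch_Suc power_add power_mult)
qed simp

text \<open>Base q^2 with b = kq, \<open>\<beta>\<close> = q and u = 0. The two factors
  \<open>hqpoch 0 1\<close>, from u = 0 and from the limit in n, have cancelling signs and give
  q^(2(n^2-n)); \<open>\<beta> ^ n\<close> adds q^n.\<close>

lemma even_quadratic_series:
  fixes q k :: complex
  assumes "norm q < 1" "q \<noteq> 0" "k \<noteq> 1"
  shows "(\<lambda>n. (1 - k * q ^ (4 * n)) * qpoch k q (2 * n) * q ^ (2 * n\<^sup>2 - n)
              / ((1 - k) * qpoch q q (2 * n)))
          sums (qpoch_inf (k * q\<^sup>2) (q\<^sup>2) / qpoch_inf q (q\<^sup>2))"
proof -
  have p: "norm (q\<^sup>2) < 1" using assms(1) by (simp add: norm_power power_less_one_iff)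
  have odd: "q * (q\<^sup>2) ^ i \<noteq> 1" for i
    using power_neq_1[OF assms(1), of "2 * i"] by (simp add: power_mult)
  have e: "(1 - k * (q\<^sup>2) ^ (2 * n)) / (1 - k)
       * (qpoch k (q\<^sup>2) n * qpoch (k * q) (q\<^sup>2) n * hqpoch 0 1 (q\<^sup>2) n * hqpoch 0 1 (q\<^sup>2) n * q ^ n)
       / (qpoch (q\<^sup>2) (q\<^sup>2) n * qpoch q (q\<^sup>2) n * qpoch (k * q\<^sup>2 * 0) (q\<^sup>2) n)
     = (1 - k * q ^ (4 * n)) * qpoch k q (2 * n) * q ^ (2 * n\<^sup>2 - n) / ((1 - k) * qpoch q q (2 * n))" for n
  proof -
    have "n \<le> n\<^sup>2" by (simp add: power2_eq_square)
    then have e: "2 * n\<^sup>2 - n = (n\<^sup>2 - n) + (n\<^sup>2 - n) + n" by simp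
    have "(- 1) ^ n * ((- 1) ^ n * x) = x" for x :: complex
      by (simp flip: mult.assoc power_mult_distrib)
    moreover have "(q\<^sup>2) ^ (2 * n) = q ^ (4 * n)" by (simp flip: power_mult)
    ultimately show ?thesis
      unfolding e qpoch_double by (simp add: hqpoch_0_1 power2_eq_square[of q, symmetric] qpoch_def[of 0] power_add mult_ac)
  qed
  show ?thesis
    using quadratic_sum_limit[OF p _ _ assms(3) odd, of "k * q" 0, unfolded e] assms(2)
    by (simp add: power2_eq_square)
qed

text \<open>Now u = -1/q, so that \<open>\<beta>\<close> u = -1 and kq^2 u = -kq. Extracting
  (-1/q)^n from the factor of u cancels both the sign of \<open>hqpoch 0 1\<close> and
  \<open>\<beta> ^ n\<close> = q^n.\<close>

lemma even_quadratic_series_with_factor: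
  fixes q k :: complex
  assumes "norm q < 1" "q \<noteq> 0" "k \<noteq> 1" and nz: "\<And>n. qpoch (- k * q) (q\<^sup>2) n \<noteq> 0"
  shows "(\<lambda>n. (1 - k * q ^ (4 * n)) * qpoch (- q) (q\<^sup>2) n * qpoch k q (2 * n) * q ^ (n\<^sup>2 - n)
              / ((1 - k) * qpoch (- k * q) (q\<^sup>2) n * qpoch q q (2 * n)))
          sums (qpochs_inf [k * q\<^sup>2, - 1] (q\<^sup>2) / qpochs_inf [- k * q, q] (q\<^sup>2))"
proof -
  have p: "norm (q\<^sup>2) < 1" using assms(1) by (simp add: norm_power power_less_one_iff)
  have odd: "q * (q\<^sup>2) ^ i \<noteq> 1" for i
    using power_neq_1[OF assms(1), of "2 * i"] by (simp add: power_mult)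
  have c: "k * q\<^sup>2 * (- 1 / q) = - k * q" "q * (- 1 / q) = - 1"
    using assms(2) by (simp_all add: power2_eq_square)
  have nz': "k * q\<^sup>2 * (- 1 / q) * (q\<^sup>2) ^ i \<noteq> 1" for i
    using nz[of "Suc i"] unfolding c qpoch_Suc by (metis mult_eq_0_iff right_minus_eq)
  have e: "(1 - k * (q\<^sup>2) ^ (2 * n)) / (1 - k)
       * (qpoch k (q\<^sup>2) n * qpoch (k * q) (q\<^sup>2) n * hqpoch (- 1 / q) 1 (q\<^sup>2) n * hqpoch 0 1 (q\<^sup>2) n * q ^ n)
       / (qpoch (q\<^sup>2) (q\<^sup>2) n * qpoch q (q\<^sup>2) n * qpoch (k * q\<^sup>2 * (- 1 / q)) (q\<^sup>2) n)
     = (1 - k * q ^ (4 * n)) * qpoch (- q) (q\<^sup>2) n * qpoch k q (2 * n) * q ^ (n\<^sup>2 - n)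
              / ((1 - k) * qpoch (- k * q) (q\<^sup>2) n * qpoch q q (2 * n))" for n
  proof -
    have h: "hqpoch (- 1 / q) 1 (q\<^sup>2) n = (- 1 / q) ^ n * qpoch (- q) (q\<^sup>2) n"
      using hqpoch_scale[of "- 1 / q" 1 "- q" "q\<^sup>2" n] assms(2) by (simp add: hqpoch_one_left)
    have cancel: "(- 1 / q) ^ n * ((- 1) ^ n * q ^ n) = 1"
      using assms(2) by (simp flip: power_mult_distrib)
    have "hqpoch (- 1 / q) 1 (q\<^sup>2) n * hqpoch 0 1 (q\<^sup>2) n * q ^ n
        = ((- 1 / q) ^ n * ((- 1) ^ n * q ^ n)) * (qpoch (- q) (q\<^sup>2) n * q ^ (n\<^sup>2 - n))"
      unfolding h hqpoch_0_1 by (simp only: mult_ac)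
    then have h0: "hqpoch (- 1 / q) 1 (q\<^sup>2) n * hqpoch 0 1 (q\<^sup>2) n * q ^ n = qpoch (- q) (q\<^sup>2) n * q ^ (n\<^sup>2 - n)"
      unfolding cancel by simp
    have "(q\<^sup>2) ^ (2 * n) = q ^ (4 * n)" by (simp flip: power_mult)
    then show ?thesis
      unfolding qpoch_double c unfolding mult.assoc unfolding h0[unfolded mult.assoc]
      by (simp add: power2_eq_square[of q, symmetric] mult_ac)
  qed
  show ?thesis
    using quadratic_sum_limit[OF p _ _ assms(3) odd nz', of "k * q", unfolded e, unfolded c] assms(2)
    by (simp add: qpochs_inf_def power2_eq_square mult.commute[of "qpoch_inf q _"])
qed

section \<open>The telescoping series (iii)\<close>

text \<open>With x = q^(N+1) the induction step is 1 - k x^2 = (1 - x) + x (1 - k x): the first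
  summand cancels the previous partial sum, the second is the new one.\<close>

lemma telescoping_qpoch_sum:
  assumes "\<And>j. q ^ Suc j \<noteq> 1" "k \<noteq> 1"
  shows "(\<Sum>n\<le>N. (1 - k * q ^ (2 * n)) * qpoch k q n * (- 1) ^ n * q ^ (n * (n - 1) div 2)
              / ((1 - k) * qpoch q q n))
    = (- 1) ^ N * q ^ (N * Suc N div 2) * (qpoch (k * q) q N / qpoch q q N)"
proof (induction N)
  case 0
  then show ?case using assms by simp
next
  case (Suc N)
  have e: "Suc N * (Suc N - 1) div 2 = N * Suc N div 2" "Suc N * Suc (Suc N) div 2 = N * Suc N div 2 + Suc N"
    by (simp_all add: mult.commute)
  have k: "qpoch k q (Suc N) = (1 - k) * qpoch (k * q) q N"
    using qpoch_add[of k q 1 N] by (simp add: qpoch_def)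
  have nz: "qpoch q q N \<noteq> 0" "1 - q * q ^ N \<noteq> 0"
    using assms(1) by (auto simp: qpoch_eq_0_iff)
  show ?case
    unfolding sum.atMost_Suc Suc e unfolding k unfolding qpoch_Suc
    using nz assms(2)
    by (simp add: divide_simps power_add mult_2 power_mult) (simp add: algebra_simps)
qed

text \<open>In the closed form of the partial sums the quotient of shifted factorials converges,
  while the power of q in front tends to 0.\<close>

lemma alternating_series:
  fixes q k :: complex
  assumes "norm q < 1" "k \<noteq> 1"
  shows "(\<lambda>n. (1 - k * q ^ (2 * n)) * qpoch k q n * (- 1) ^ n * q ^ (n * (n - 1) div 2)
              / ((1 - k) * qpoch q q n)) sums 0"
proof -
  have q1: "q ^ Suc j \<noteq> 1" for j by (rule power_neq_1[OF assms(1)])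
  have "(\<lambda>n. qpoch (k * q) q n / qpoch q q n) \<longlonglongrightarrow> qpoch_inf (k * q) q / qpoch_inf q q"
    using q1 by (intro tendsto_divide tendsto_qpoch_inf assms(1) qpoch_inf_nonzero) auto
  moreover have "(\<lambda>n. (- 1) ^ n * q ^ (n * Suc n div 2)) \<longlonglongrightarrow> 0"
  proof (rule Lim_null_comparison)
    show "(\<lambda>n. norm q ^ n) \<longlonglongrightarrow> 0" using assms(1) by (intro LIMSEQ_power_zero) simp
    have "n \<le> n * Suc n div 2" for n by (cases n) auto
    then show "\<forall>\<^sub>F n in sequentially. norm ((- 1) ^ n * q ^ (n * Suc n div 2)) \<le> norm q ^ n"
      using assms(1) by (simp add: norm_mult norm_power power_decreasing)
  qed
  ultimately have "(\<lambda>n. (- 1) ^ n * q ^ (n * Suc n div 2) * (qpoch (k * q) q n / qpoch q q n))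
      \<longlonglongrightarrow> 0 * (qpoch_inf (k * q) q / qpoch_inf q q)"
    by (intro tendsto_mult)
  then show ?thesis
    unfolding sums_def_le telescoping_qpoch_sum[OF q1 assms(2)] by simp
qed

theorem corollary15:
  fixes q :: complex
  assumes "norm q < 1" and "q \<noteq> 0"
  shows
    "(\<forall>(N::nat) (k::complex) (y::complex) (z::complex) (sk::complex) (sq::complex).
        N > 0 \<longrightarrow> k \<noteq> 0 \<longrightarrow> y \<noteq> 0 \<longrightarrow> z \<noteq> 0 \<longrightarrow>
        sk\<^sup>2 = k \<longrightarrow> sq\<^sup>2 = q \<longrightarrow>
        (\<forall>n\<le>N. qpochs [q, sk, - sk, q * k / y, q * k / z, sq, k * q ^ (1 + N),
                        y * z * q powi (- int N)] q n \<noteq> 0) \<longrightarrow>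
        qpochs [q * k / y, q * k / z, q, q / (y * z)] q N \<noteq> 0 \<longrightarrow>
        (\<forall>n\<in>{1..N}. qpochs [q / y, q / z, q ^ (1 + N), y * z * q powi (- int N) / k] q n \<noteq> 0) \<longrightarrow>
        basic_hypergeometric
          [k, q * sk, - q * sk, y, z, k * sq, k * q ^ (1 + N) / (y * z), q powi (- int N)]
          [sk, - sk, q * k / y, q * k / z, sq, k * q ^ (1 + N), y * z * q powi (- int N)]
          q sq
        = qpochs [q * k, q * k / (y * z), q / y, q / z] q N
            / qpochs [q * k / y, q * k / z, q, q / (y * z)] q N
          * (1 + (\<Sum>n=1..N. (1 + q ^ n)
                * qpochs [y, z, k * q ^ (1 + N) / (y * z), q powi (- int N)] q n
                / qpochs [q / y, q / z, q ^ (1 + N), y * z * q powi (- int N) / k] q n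
                * (sq / k) ^ n)))
     \<and> (\<forall>k::complex. 1 - k \<noteq> 0 \<longrightarrow>
        (\<lambda>n. (1 - k * q ^ (4 * n)) * qpoch k q (2 * n) * q ^ (2 * n\<^sup>2 - n)
              / ((1 - k) * qpoch q q (2 * n)))
          sums (qpoch_inf (k * q\<^sup>2) (q\<^sup>2) / qpoch_inf q (q\<^sup>2)))
     \<and> (\<forall>k::complex. 1 - k \<noteq> 0 \<longrightarrow>
        (\<lambda>n. (1 - k * q ^ (2 * n)) * qpoch k q n * (- 1) ^ n * q ^ (n * (n - 1) div 2)
              / ((1 - k) * qpoch q q n))
          sums 0)
     \<and> (\<forall>k::complex. 1 - k \<noteq> 0 \<longrightarrow> (\<forall>n. qpoch (- k * q) (q\<^sup>2) n \<noteq> 0) \<longrightarrow>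
        (\<lambda>n. (1 - k * q ^ (4 * n)) * qpoch (- q) (q\<^sup>2) n * qpoch k q (2 * n) * q ^ (n\<^sup>2 - n)
              / ((1 - k) * qpoch (- k * q) (q\<^sup>2) n * qpoch q q (2 * n)))
          sums (qpochs_inf [k * q\<^sup>2, - 1] (q\<^sup>2) / qpochs_inf [- k * q, q] (q\<^sup>2)))"
proof (intro conjI allI impI)
  fix N :: nat and k y z sk sq :: complex
  assume "N > 0" "k \<noteq> 0" "y \<noteq> 0" "z \<noteq> 0" "sk\<^sup>2 = k" "sq\<^sup>2 = q"
    "\<forall>n\<le>N. qpochs [q, sk, - sk, q * k / y, q * k / z, sq, k * q ^ (1 + N),
                        y * z * q powi (- int N)] q n \<noteq> 0"
    "qpochs [q * k / y, q * k / z, q, q / (y * z)] q N \<noteq> 0"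
    "\<forall>n\<in>{1..N}. qpochs [q / y, q / z, q ^ (1 + N), y * z * q powi (- int N) / k] q n \<noteq> 0"
  then show "basic_hypergeometric
          [k, q * sk, - q * sk, y, z, k * sq, k * q ^ (1 + N) / (y * z), q powi (- int N)]
          [sk, - sk, q * k / y, q * k / z, sq, k * q ^ (1 + N), y * z * q powi (- int N)]
          q sq
        = qpochs [q * k, q * k / (y * z), q / y, q / z] q N
            / qpochs [q * k / y, q * k / z, q, q / (y * z)] q N
          * (1 + (\<Sum>n=1..N. (1 + q ^ n)
                * qpochs [y, z, k * q ^ (1 + N) / (y * z), q powi (- int N)] q n
                / qpochs [q / y, q / z, q ^ (1 + N), y * z * q powi (- int N) / k] q n
                * (sq / k) ^ n))"
    by (rule bailey_terminating_sum[OF power_neq_1[OF assms(1)] assms(2)])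
next
  fix k :: complex
  assume "1 - k \<noteq> 0"
  then show "(\<lambda>n. (1 - k * q ^ (4 * n)) * qpoch k q (2 * n) * q ^ (2 * n\<^sup>2 - n)
              / ((1 - k) * qpoch q q (2 * n)))
          sums (qpoch_inf (k * q\<^sup>2) (q\<^sup>2) / qpoch_inf q (q\<^sup>2))"
    by (intro even_quadratic_series[OF assms]) simp
next
  fix k :: complex
  assume "1 - k \<noteq> 0"
  then show "(\<lambda>n. (1 - k * q ^ (2 * n)) * qpoch k q n * (- 1) ^ n * q ^ (n * (n - 1) div 2)
              / ((1 - k) * qpoch q q n)) sums 0"
    by (intro alternating_series[OF assms(1)]) simp
next
  fix k :: complex
  assume "1 - k \<noteq> 0" and "\<forall>n. qpoch (- k * q) (q\<^sup>2) n \<noteq> 0"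
  then show "(\<lambda>n. (1 - k * q ^ (4 * n)) * qpoch (- q) (q\<^sup>2) n * qpoch k q (2 * n) * q ^ (n\<^sup>2 - n)
              / ((1 - k) * qpoch (- k * q) (q\<^sup>2) n * qpoch q q (2 * n)))
          sums (qpochs_inf [k * q\<^sup>2, - 1] (q\<^sup>2) / qpochs_inf [- k * q, q] (q\<^sup>2))"
    by (intro even_quadratic_series_with_factor[OF assms]) auto
qed

end
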